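(* Let $A$ be a finite dimensional associative algebra (not necessarily unital) over a field, let $R$ be the radical of $A$, and suppose that $A/R$ is separable. Let $I$ be a left ideal of $A$. Then there exists a semisimple subalgebra $S$ of $A$ such that $A = S \oplus R$ and $I = I_S \oplus I_R$, where $I_S = I \cap S$ and $I_R = I \cap R$.
   Context: Algebras are associative and are not required to contain an identity element; subalgebras are likewise not required to be unital. Left ideals of the algebra $A$ are linear subspaces $I \subseteq A$ with $AI \subseteq I$. The radical $R$ of a finite dimensional algebra $A$ is its largest nilpotent two-sided ideal. The zero algebra counts as semisimple and as separable. Separable means that the algebra is semisimple and remains semisimple after every extension of the base field. The symbol $\oplus$ denotes internal direct sum of vector subspaces. *)

theory Defs
  imports "HOL-Algebra.Algebraic_Closure_Type" "HOL-Algebra.Module" "HOL-Algebra.QuotRing"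
begin

text \<open>
  The given algebra is a type of class \<^class>\<open>ring\<close> (associative, no identity required) together
  with a scalar multiplication by a field.
\<close>

locale fin_dim_algebra = vector_space scale
  for scale :: "'k::field \<Rightarrow> 'a::ring \<Rightarrow> 'a" (infixr \<open>*s\<close> 75) +
  assumes scale_mult_left: "(c *s x) * y = c *s (x * y)"
    and scale_mult_right: "x * (c *s y) = c *s (x * y)"
    and finite_dimensional: "\<exists>B. finite_dimensional_vector_space scale B"

text \<open>
  Quotients and scalar extensions are not types, so the algebra-theoretic notions are stated for
  the record type \<open>module\<close> over a field given as a record. Its component \<open>one\<close> is
  never used, as algebras need not have an identity; it is filled with zero below.
\<close>

definition algebra_of_type :: "('k::field \<Rightarrow> 'a::ring \<Rightarrow> 'a) \<Rightarrow> ('k, 'a) module" where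
  "algebra_of_type scale =
    \<lparr>carrier = UNIV, monoid.mult = (*), one = 0, ring.zero = 0, add = (+), module.smult = scale\<rparr>"

definition is_subalgebra :: "'k ring \<Rightarrow> ('k, 'a) module \<Rightarrow> 'a set \<Rightarrow> bool" where
  "is_subalgebra F A S \<longleftrightarrow> submodule S F A \<and> (\<forall>x\<in>S. \<forall>y\<in>S. x \<otimes>\<^bsub>A\<^esub> y \<in> S)"

definition is_left_ideal :: "'k ring \<Rightarrow> ('k, 'a) module \<Rightarrow> 'a set \<Rightarrow> bool" where
  "is_left_ideal F A I \<longleftrightarrow> submodule I F A \<and> (\<forall>a\<in>carrier A. \<forall>x\<in>I. a \<otimes>\<^bsub>A\<^esub> x \<in> I)"

definition is_two_sided_ideal :: "'k ring \<Rightarrow> ('k, 'a) module \<Rightarrow> 'a set \<Rightarrow> bool" where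
  "is_two_sided_ideal F A I \<longleftrightarrow>
    is_left_ideal F A I \<and> (\<forall>a\<in>carrier A. \<forall>x\<in>I. x \<otimes>\<^bsub>A\<^esub> a \<in> I)"

text \<open>\<open>foldl (\<otimes>) x xs\<close> is the product of the nonempty list \<open>x # xs\<close>, so this says that
  \<open>I\<close> to the power \<open>n + 1\<close> vanishes for some \<open>n\<close>.\<close>

definition nilpotent_set :: "('k, 'a) module \<Rightarrow> 'a set \<Rightarrow> bool" where
  "nilpotent_set A I \<longleftrightarrow>
    (\<exists>n. \<forall>x xs. x \<in> I \<and> set xs \<subseteq> I \<and> length xs = n \<longrightarrow> foldl (\<otimes>\<^bsub>A\<^esub>) x xs = \<zero>\<^bsub>A\<^esub>)"

definition is_radical :: "'k ring \<Rightarrow> ('k, 'a) module \<Rightarrow> 'a set \<Rightarrow> bool" where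
  "is_radical F A R \<longleftrightarrow>
    is_two_sided_ideal F A R \<and> nilpotent_set A R \<and>
    (\<forall>J. is_two_sided_ideal F A J \<and> nilpotent_set A J \<longrightarrow> J \<subseteq> R)"

definition semisimple_algebra :: "'k ring \<Rightarrow> ('k, 'a) module \<Rightarrow> bool" where
  "semisimple_algebra F A \<longleftrightarrow> is_radical F A {\<zero>\<^bsub>A\<^esub>}"

definition is_direct_sum ::
    "'k ring \<Rightarrow> ('k, 'a) module \<Rightarrow> 'a set \<Rightarrow> 'a set \<Rightarrow> 'a set \<Rightarrow> bool" where
  "is_direct_sum F A W U V \<longleftrightarrow>
    submodule U F A \<and> submodule V F A \<and> W = U <+>\<^bsub>A\<^esub> V \<and> U \<inter> V = {\<zero>\<^bsub>A\<^esub>}"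

definition quotient_algebra :: "('k, 'a) module \<Rightarrow> 'a set \<Rightarrow> ('k, 'a set) module" where
  "quotient_algebra A I =
    \<lparr>carrier = a_rcosets\<^bsub>A\<^esub> I, monoid.mult = rcoset_mult A I, one = I, ring.zero = I, add = set_add A,
     module.smult = (\<lambda>c C. \<Union>x\<in>C. I +>\<^bsub>A\<^esub> (c \<odot>\<^bsub>A\<^esub> x))\<rparr>"

text \<open>
  The tensor product of a field extension \<open>K\<close> of \<open>F\<close> (along \<open>\<phi>\<close>) with \<open>A\<close>: the \<open>K\<close>-vector space
  on generators \<open>x\<close> from \<open>A\<close> (standing for \<open>1 \<otimes> x\<close>), modulo additivity in \<open>x\<close> and
  \<open>1 \<otimes> (c x) = \<phi> c \<otimes> x\<close>. The free space consists of the finitely supported functions and carries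
  the convolution product, in which the product of the generators \<open>x\<close> and \<open>y\<close> is the generator \<open>x y\<close>.
\<close>

definition free_algebra_on :: "'l ring \<Rightarrow> ('k, 'a) module \<Rightarrow> ('l, 'a \<Rightarrow> 'l) module" where
  "free_algebra_on K A =
    \<lparr>carrier = {f. range f \<subseteq> carrier K \<and> finite {x. f x \<noteq> \<zero>\<^bsub>K\<^esub>} \<and> {x. f x \<noteq> \<zero>\<^bsub>K\<^esub>} \<subseteq> carrier A},
     monoid.mult = (\<lambda>f g z. finsum K (\<lambda>(x, y). f x \<otimes>\<^bsub>K\<^esub> g y)
       {(x, y). f x \<noteq> \<zero>\<^bsub>K\<^esub> \<and> g y \<noteq> \<zero>\<^bsub>K\<^esub> \<and> x \<otimes>\<^bsub>A\<^esub> y = z}),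
     one = (\<lambda>_. \<zero>\<^bsub>K\<^esub>),
     ring.zero = (\<lambda>_. \<zero>\<^bsub>K\<^esub>),
     add = (\<lambda>f g x. f x \<oplus>\<^bsub>K\<^esub> g x),
     module.smult = (\<lambda>c f x. c \<otimes>\<^bsub>K\<^esub> f x)\<rparr>"

definition free_gen :: "'l ring \<Rightarrow> 'a \<Rightarrow> 'a \<Rightarrow> 'l" where
  "free_gen K x = (\<lambda>y. if y = x then \<one>\<^bsub>K\<^esub> else \<zero>\<^bsub>K\<^esub>)"

definition tensor_relations ::
    "'k ring \<Rightarrow> 'l ring \<Rightarrow> ('k \<Rightarrow> 'l) \<Rightarrow> ('k, 'a) module \<Rightarrow> ('a \<Rightarrow> 'l) set" where
  "tensor_relations F K \<phi> A =
    (let M = free_algebra_on K A; \<delta> = free_gen K in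
      {\<delta> (x \<oplus>\<^bsub>A\<^esub> y) \<ominus>\<^bsub>M\<^esub> (\<delta> x \<oplus>\<^bsub>M\<^esub> \<delta> y) | x y. x \<in> carrier A \<and> y \<in> carrier A} \<union>
      {\<delta> (c \<odot>\<^bsub>A\<^esub> x) \<ominus>\<^bsub>M\<^esub> (\<phi> c \<odot>\<^bsub>M\<^esub> \<delta> x) | c x. c \<in> carrier F \<and> x \<in> carrier A})"

definition scalar_extension ::
    "'k ring \<Rightarrow> 'l ring \<Rightarrow> ('k \<Rightarrow> 'l) \<Rightarrow> ('k, 'a) module \<Rightarrow> ('l, ('a \<Rightarrow> 'l) set) module" where
  "scalar_extension F K \<phi> A =
    quotient_algebra (free_algebra_on K A)
      (\<Inter>{H. submodule H K (free_algebra_on K A) \<and> tensor_relations F K \<phi> A \<subseteq> H})"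

text \<open>
  HOL cannot quantify over types inside a formula, so the fields \<open>K\<close> range over all field
  structures, with arbitrary carrier and operations, on subsets of one type, and over all
  embeddings of the base field into them; \<open>K\<close> is not required to be algebraic. The type
  \<open>'k alg_closure\<close> serves only as a supply of elements: it is infinite and at least as large as
  \<open>'k\<close>, so up to isomorphism every finitely generated extension of \<open>'k\<close> occurs, as does every
  extension of no larger cardinality, for example an algebraic closure. This covers all extensions:
  if \<open>B\<close> over some extension has a nonzero nilpotent ideal, then a nonzero element of it involves
  finitely many scalars and generates a nonzero nilpotent ideal already over the extension
  generated by these.
\<close>

definition separable_algebra :: "('k::field, 'a) module \<Rightarrow> bool" where
  "separable_algebra B \<longleftrightarrow>
    semisimple_algebra ring_of_type_algebra B \<and>
    (\<forall>(K :: 'k alg_closure ring) \<phi>.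
      field K \<and> \<phi> \<in> ring_hom (ring_of_type_algebra :: 'k ring) K \<longrightarrow>
      semisimple_algebra K (scalar_extension ring_of_type_algebra K \<phi> B))"

end

theory Submission
  imports Defs "HOL-Library.Function_Algebras"
begin

text \<open>
  This is the Wedderburn principal theorem, with a complement \<open>S\<close> adapted to a given left ideal
  \<open>I\<close>. The proof has two halves.

  \<^bold>\<open>Lifting.\<close> Suppose that \<open>A/R\<close> has a separability idempotent, that is a tensor
  \<open>\<Sum> \<epsilon> p q (p \<otimes> q)\<close> which commutes with every \<open>a\<close> in the sense
  \<open>\<Sum> \<epsilon> p q (a p \<otimes> q) = \<Sum> \<epsilon> p q (p \<otimes> q a)\<close> and whose product \<open>u = \<Sum> \<epsilon> p q p q\<close> is the
  identity of \<open>A/R\<close>. Start with a linear section \<open>s\<close> of the projection to \<open>A/R\<close>, regarded as a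
  projection of \<open>A\<close> with kernel \<open>R\<close>, and measure its failure to be multiplicative by the
  Hochschild cocycle \<open>f x y = s x * s y - s (x * y)\<close>. If \<open>f\<close> takes values in a power of \<open>R\<close>,
  contracting it with the tensor,
  \<open>g x = (\<Sum> \<epsilon> p q s p * f q x) + s u * f u x - f u x\<close>,
  gives a cochain whose coboundary is \<open>f\<close> modulo the next power, so that \<open>s - g\<close> is a better
  section (\<open>lifting_step\<close>). The last two summands of \<open>g\<close> compensate that \<open>u\<close> need not act as the
  identity on \<open>R\<close>. As \<open>R\<close> is nilpotent, finitely many steps give a multiplicative \<open>s\<close>, and its range is
  \<open>S\<close>. The left ideal comes for free: if \<open>s\<close> maps \<open>I\<close> into itself, then \<open>f q x \<in> I\<close>, hence
  \<open>g x \<in> I\<close> for \<open>x \<in> I\<close>, so every corrected section preserves \<open>I\<close>; and then \<open>x = s x + (x - s x)\<close>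
  splits \<open>I\<close>.

  \<^bold>\<open>The separability idempotent.\<close> Its defining conditions are linear equations over the
  base field, so a solution over the algebraic closure \<open>K\<close> can be pushed down along a linear
  retraction of \<open>K\<close> onto the base field (\<open>separability_coefficients\<close>). Over \<open>K\<close>, separability says that \<open>A/R\<close>
  extended to \<open>K\<close> has no nonzero square-zero ideals. A minimal left ideal then has the form \<open>B e\<close> with
  \<open>e B e = K e\<close>, the spaces \<open>B e\<close> and \<open>e B\<close> have dual bases \<open>x i\<close> and \<open>y i\<close>, and \<open>\<Sum> x i \<otimes> y i\<close>
  commutes with every element. Its product is a central idempotent, and adding up such tensors
  until the idempotents exhaust the algebra gives \<open>separability_tensor_exists\<close>. The
  identification of the scalar extension, which is a quotient of a free
  algebra, with an algebra of coordinate vectors occupies the part in between.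
\<close>

section \<open>Linear dependence and eigenvectors\<close>

lemma (in vector_space) dim_strict_mono_in_finite_span:
  assumes "finite T" "subspace U" "U \<subset> V" "V \<subseteq> span T"
  shows "dim U < dim V"
proof -
  obtain B where B: "B \<subseteq> U" "independent B" "U \<subseteq> span B" "card B = dim U"
    using basis_exists by blast
  obtain v where v: "v \<in> V" "v \<notin> U" using assms by blast
  have "span B = U"
    using B assms(2) span_minimal by blast
  then have ind: "independent (insert v B)"
    using independent_insertI B v by blast
  obtain C where C: "insert v B \<subseteq> C" "C \<subseteq> V" "independent C" "V \<subseteq> span C"
    using maximal_independent_subset_extend[OF _ ind, of V] B v assms by blast
  have fC: "finite C" using independent_span_bound[OF assms(1) C(3)] C(2) assms(4) by blast
  have "v \<notin> B" using B v by blast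
  then have "card (insert v B) = Suc (card B)"
    using finite_subset[OF C(1) fC] by simp
  then show ?thesis using card_mono[OF fC C(1)] B(4) basis_card_eq_dim[OF C(2,4,3)] by simp
qed

lemma (in vector_space) nontrivial_relation_in_finite_span:
  fixes v :: "nat \<Rightarrow> 'b"
  assumes T: "finite T" and v: "\<And>i. i \<le> card T \<Longrightarrow> v i \<in> span T"
  shows "\<exists>c. (\<exists>i\<le>card T. c i \<noteq> 0) \<and> (\<Sum>i\<le>card T. scale (c i) (v i)) = 0"
proof (cases "inj_on v {..card T}")
  case True
  let ?S = "v ` {..card T}"
  have "\<not> independent ?S"
    using independent_span_bound[OF T, of ?S] v card_image[OF True] by auto
  then obtain c where c: "\<exists>w\<in>?S. c w \<noteq> 0" "(\<Sum>w\<in>?S. scale (c w) w) = 0"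
    using dependent_finite[of ?S] by auto
  then show ?thesis
    using True by (intro exI[of _ "c \<circ> v"]) (auto simp: sum.reindex)
next
  case False
  then obtain i j where ij: "i \<le> card T" "j \<le> card T" "i \<noteq> j" "v i = v j"
    by (auto simp: inj_on_def)
  define c :: "nat \<Rightarrow> 'a" where "c k = (if k = i then 1 else if k = j then -1 else 0)" for k
  have "(\<Sum>k\<le>card T. scale (c k) (v k)) = (\<Sum>k\<in>{i, j}. scale (c k) (v k))"
    using ij by (intro sum.mono_neutral_right) (auto simp: c_def)
  also have "\<dots> = 0" using ij by (simp add: c_def)
  finally show ?thesis using ij by (intro exI[of _ c]) (auto simp: c_def)
qed

text \<open>
  The vectors \<open>x, f x, f (f x), \<dots>\<close> are linearly dependent, so some nonzero polynomial in \<open>f\<close>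
  kills \<open>x\<close>; splitting off one linear factor after the other, the last vector before zero is an
  eigenvector. Working with polynomials in \<open>f\<close> applied to \<open>x\<close> avoids a matrix for \<open>f\<close>.
\<close>

lemma (in vector_space) eigenvector_exists:
  fixes f :: "'b \<Rightarrow> 'b"
  assumes closed: "\<And>q :: 'a poly. degree q > 0 \<Longrightarrow> \<exists>c. poly q c = 0"
    and f: "\<And>x y. f (x + y) = f x + f y" "\<And>c x. f (scale c x) = scale c (f x)"
    and L: "subspace L" "\<And>x. x \<in> L \<Longrightarrow> f x \<in> L"
    and T: "finite T" "L \<subseteq> span T"
    and x: "x \<in> L" "x \<noteq> 0"
  shows "\<exists>c. \<exists>y\<in>L. y \<noteq> 0 \<and> f y = scale c y"
proof -
  \<comment> \<open>Horner evaluation: the polynomial q in the operator f, applied to x\<close>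
  define ev where "ev = (\<lambda>q x. fold_coeffs (\<lambda>c y. scale c x + f y) q 0)"
  have f0: "f 0 = 0" using f(2)[of 0 0] by simp
  have ev0: "ev 0 x = 0" by (simp add: ev_def)
  have evp: "ev (pCons c q) x = scale c x + f (ev q x)" for c q
  proof (cases "c = 0 \<and> q = 0")
    case True then show ?thesis using f0 by (simp add: ev_def)
  next
    case False
    then have "fold_coeffs h (pCons c q) = h c \<circ> fold_coeffs h q" for h :: "'a \<Rightarrow> 'b \<Rightarrow> 'b"
      by (cases "c = 0") (simp_all add: fold_coeffs_pCons_coeff_not_0_eq fold_coeffs_pCons_not_0_0_eq)
    then show ?thesis by (simp add: ev_def)
  qed
  have ev_in: "ev q x \<in> L" for q
    by (induction q) (use L x in \<open>auto simp: ev0 evp subspace_0 subspace_add subspace_scale\<close>)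
  have ev_add: "ev (q + r) x = ev q x + ev r x" for q r
    by (induction q r rule: poly_induct2) (simp_all add: ev0 evp f scale_left_distrib algebra_simps)
  have ev_smult: "ev (smult c q) x = scale c (ev q x)" for c q
    by (induction q) (simp_all add: ev0 evp f scale_right_distrib)
  have ev_monom: "ev (monom c n) x = scale c ((f ^^ n) x)" for c n
    by (induction n) (simp_all add: monom_0 monom_Suc evp ev0 f0 f)
  have "(f ^^ i) x \<in> L" for i using L x by (induction i) auto
  then obtain c i where c: "(\<Sum>i\<le>card T. scale (c i) ((f ^^ i) x)) = 0" "c i \<noteq> 0" "i \<le> card T"
    using nontrivial_relation_in_finite_span[OF T(1), of "\<lambda>i. (f ^^ i) x"] T(2) by blast
  define p where "p = (\<Sum>i\<le>card T. monom (c i) i)"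
  have "coeff p i = c i" using c(3) by (simp add: p_def coeff_sum)
  then have "p \<noteq> 0" using c(2) by auto
  have "ev (\<Sum>i\<in>A. monom (c i) i) x = (\<Sum>i\<in>A. scale (c i) ((f ^^ i) x))" if "finite A" for A
    using that by (induction A) (simp_all add: ev0 ev_add ev_monom)
  then have "ev p x = 0" using c(1) by (simp add: p_def)
  let ?eigen = "\<exists>c. \<exists>y\<in>L. y \<noteq> 0 \<and> f y = scale c y"
  have "p \<noteq> 0 \<longrightarrow> ev p x = 0 \<longrightarrow> ?eigen" for p
  proof (induction "degree p" arbitrary: p rule: less_induct)
    case less
    show ?case
    proof (intro impI)
      assume p: "p \<noteq> 0" "ev p x = 0"
      have "degree p > 0"
      proof (rule ccontr)
        assume "\<not> degree p > 0"
        then obtain c where "p = [:c:]" using degree_eq_zeroE by blast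
        then show False using p x by (auto simp: ev0 evp f0)
      qed
      then obtain c where "poly p c = 0" using closed by blast
      then obtain q where q: "p = [:-c, 1:] * q" by (auto simp: poly_eq_0_iff_dvd dvd_def)
      then have "q \<noteq> 0" using p by auto
      then have "degree q < degree p" by (subst q, subst degree_mult_eq) auto
      have "p = pCons 0 q + smult (-c) q" by (simp add: q)
      then have e: "f (ev q x) = scale c (ev q x)"
        using p(2) by (simp add: ev_add ev_smult evp del: smult_minus_left)
      show ?eigen
      proof (cases "ev q x = 0")
        case True
        then show ?eigen using less \<open>q \<noteq> 0\<close> \<open>degree q < degree p\<close> by blast
      next
        case False
        then show ?eigen using e ev_in by blast
      qed
    qed
  qed
  then show ?thesis using \<open>p \<noteq> 0\<close> \<open>ev p x = 0\<close> by blast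
qed

section \<open>Separability tensors over algebraically closed fields\<close>

text \<open>
  The multiplication is a parameter and not that of a type class, since the algebra of coordinate
  vectors considered below has structure constants that depend on the context.
\<close>

locale bilinear_algebra = vector_space scale
  for scale :: "'k::field \<Rightarrow> 'v::ab_group_add \<Rightarrow> 'v" (infixr \<open>*s\<close> 75) +
  fixes mult :: "'v \<Rightarrow> 'v \<Rightarrow> 'v" (infixl \<open>\<bullet>\<close> 70)
  assumes mult_assoc: "(x \<bullet> y) \<bullet> z = x \<bullet> (y \<bullet> z)"
    and mult_add_left: "(x + y) \<bullet> z = x \<bullet> z + y \<bullet> z"
    and mult_add_right: "x \<bullet> (y + z) = x \<bullet> y + x \<bullet> z"
    and mult_scale_left: "(c *s x) \<bullet> y = c *s (x \<bullet> y)"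
    and mult_scale_right: "x \<bullet> (c *s y) = c *s (x \<bullet> y)"
begin

lemma mult_null_left [simp]: "0 \<bullet> x = 0"
  using mult_scale_left[of 0 0 x] by simp

lemma mult_null_right [simp]: "x \<bullet> 0 = 0"
  using mult_scale_right[of x 0 0] by simp

lemma mult_diff_left: "(x - y) \<bullet> z = x \<bullet> z - y \<bullet> z"
  using mult_add_left[of "x - y" y z] by (simp add: eq_diff_eq)

lemma mult_diff_right: "z \<bullet> (x - y) = z \<bullet> x - z \<bullet> y"
  using mult_add_right[of z "x - y" y] by (simp add: eq_diff_eq)

lemma mult_sum_left: "(\<Sum>i\<in>A. f i) \<bullet> z = (\<Sum>i\<in>A. f i \<bullet> z)"
  by (induction A rule: infinite_finite_induct) (simp_all add: mult_add_left)

lemma mult_sum_right: "z \<bullet> (\<Sum>i\<in>A. f i) = (\<Sum>i\<in>A. z \<bullet> f i)"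
  by (induction A rule: infinite_finite_induct) (simp_all add: mult_add_right)

end

text \<open>
  The algebra under consideration is the finite-dimensional subspace \<open>W\<close>; the multiplication
  is defined on the whole type, which frees the algebraic laws from side conditions.
  In finite dimension the absence of nonzero square-zero ideals is semisimplicity.
\<close>

locale semiprime_algebra = bilinear_algebra scale mult
  for scale :: "'k::field \<Rightarrow> 'v::ab_group_add \<Rightarrow> 'v" (infixr \<open>*s\<close> 75)
    and mult :: "'v \<Rightarrow> 'v \<Rightarrow> 'v" (infixl \<open>\<bullet>\<close> 70) +
  fixes W T :: "'v set"
  assumes subspace_W: "subspace W"
    and W_mult: "x \<in> W \<Longrightarrow> y \<in> W \<Longrightarrow> x \<bullet> y \<in> W"
    and finite_T: "finite T" and W_span: "W \<subseteq> span T"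
    and no_square_zero_ideal:
      "\<lbrakk>subspace J; J \<subseteq> W; \<And>w x. w \<in> W \<Longrightarrow> x \<in> J \<Longrightarrow> w \<bullet> x \<in> J;
        \<And>w x. w \<in> W \<Longrightarrow> x \<in> J \<Longrightarrow> x \<bullet> w \<in> J; \<And>x y. x \<in> J \<Longrightarrow> y \<in> J \<Longrightarrow> x \<bullet> y = 0\<rbrakk>
       \<Longrightarrow> J \<subseteq> {0}"
begin

definition left_ideal :: "'v set \<Rightarrow> bool" where
  "left_ideal L \<longleftrightarrow> subspace L \<and> L \<subseteq> W \<and> (\<forall>w\<in>W. \<forall>x\<in>L. w \<bullet> x \<in> L)"

lemma left_idealD:
  assumes "left_ideal L"
  shows "subspace L" "x \<in> L \<Longrightarrow> x \<in> W" "w \<in> W \<Longrightarrow> x \<in> L \<Longrightarrow> w \<bullet> x \<in> L"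
  using assms by (auto simp: left_ideal_def)

lemma W_closed [simp]:
  "0 \<in> W" "x \<in> W \<Longrightarrow> y \<in> W \<Longrightarrow> x + y \<in> W" "x \<in> W \<Longrightarrow> y \<in> W \<Longrightarrow> x - y \<in> W"
  "x \<in> W \<Longrightarrow> c *s x \<in> W" "x \<in> W \<Longrightarrow> y \<in> W \<Longrightarrow> x \<bullet> y \<in> W"
  using subspace_W W_mult by (auto simp: subspace_0 subspace_add subspace_diff subspace_scale)

lemma W_sum: "(\<And>i. i \<in> A \<Longrightarrow> f i \<in> W) \<Longrightarrow> sum f A \<in> W"
  using subspace_W subspace_sum by blast

text \<open>
  The two-sided ideal \<open>L + L W\<close> generated by a square-zero left ideal is again square-zero,
  because \<open>L W L \<subseteq> L L\<close>.
\<close>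

lemma square_zero_left_ideal:
  assumes L: "left_ideal L" and sq: "\<And>x y. x \<in> L \<Longrightarrow> y \<in> L \<Longrightarrow> x \<bullet> y = 0"
  shows "L \<subseteq> {0}"
proof -
  let ?G = "L \<union> {x \<bullet> w | x w. x \<in> L \<and> w \<in> W}"
  have GW: "?G \<subseteq> W" using left_idealD[OF L] by auto
  have G1: "x \<in> ?G" if "x \<in> L" for x using that by blast
  have G2: "x \<bullet> w \<in> ?G" if "x \<in> L" "w \<in> W" for x w using that by blast
  have G_cases: "P g" if g: "g \<in> ?G" and P: "\<And>x. x \<in> L \<Longrightarrow> P x" "\<And>x w. x \<in> L \<Longrightarrow> w \<in> W \<Longrightarrow> P (x \<bullet> w)" for P g
    using g by (elim UnE CollectE exE conjE) (simp_all only: P)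
  have G_left: "w \<bullet> g \<in> ?G" if w: "w \<in> W" and g: "g \<in> ?G" for w g
    using g
  proof (rule G_cases)
    show "w \<bullet> x \<in> ?G" if "x \<in> L" for x
      using left_idealD(3)[OF L w that] by (rule G1)
    show "w \<bullet> (x \<bullet> v) \<in> ?G" if "x \<in> L" "v \<in> W" for x v
      using G2[OF left_idealD(3)[OF L w that(1)] that(2)] by (simp only: mult_assoc)
  qed
  have G_right: "g \<bullet> w \<in> ?G" if w: "w \<in> W" and g: "g \<in> ?G" for w g
    using g
  proof (rule G_cases)
    show "x \<bullet> w \<in> ?G" if "x \<in> L" for x
      using that w by (rule G2)
    show "x \<bullet> v \<bullet> w \<in> ?G" if "x \<in> L" "v \<in> W" for x v
      unfolding mult_assoc using that w W_mult by (intro G2)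
  qed
  have lin: "subspace {x. P x}" if "P 0" "\<And>x y. P x \<Longrightarrow> P y \<Longrightarrow> P (x + y)" "\<And>c x. P x \<Longrightarrow> P (c *s x)" for P
    using that by (simp add: subspace_def)
  have "span ?G \<subseteq> {0}"
  proof (rule no_square_zero_ideal)
    show "subspace (span ?G)" by simp
    show "span ?G \<subseteq> W" using GW subspace_W span_minimal by blast
    show "w \<bullet> x \<in> span ?G" if "w \<in> W" "x \<in> span ?G" for w x
      using that(2)
    proof (induction rule: span_induct)
      show "subspace {x. w \<bullet> x \<in> span ?G}"
        by (rule lin) (auto simp: mult_add_right mult_scale_right span_zero span_add span_scale)
      fix x assume "x \<in> ?G"
      then have "w \<bullet> x \<in> ?G" by (rule G_left[OF that(1)])
      then show "w \<bullet> x \<in> span ?G" by (rule span_base)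
    qed
    show "x \<bullet> w \<in> span ?G" if "w \<in> W" "x \<in> span ?G" for w x
      using that(2)
    proof (induction rule: span_induct)
      show "subspace {x. x \<bullet> w \<in> span ?G}"
        by (rule lin) (auto simp: mult_add_left mult_scale_left span_zero span_add span_scale)
      fix x assume "x \<in> ?G"
      then have "x \<bullet> w \<in> ?G" by (rule G_right[OF that(1)])
      then show "x \<bullet> w \<in> span ?G" by (rule span_base)
    qed
    have ann: "a \<bullet> g = 0" if "a \<in> L" "g \<in> ?G" for a g
      using that(2) by (rule G_cases) (simp_all add: sq[OF that(1)] mult_assoc[symmetric])
    have 1: "x \<bullet> y = 0" if "x \<in> ?G" "y \<in> ?G" for x y
      using that(1)
    proof (rule G_cases)
      show "a \<bullet> y = 0" if "a \<in> L" for a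
        using that \<open>y \<in> ?G\<close> by (rule ann)
      show "a \<bullet> w \<bullet> y = 0" if "a \<in> L" "w \<in> W" for a w
        unfolding mult_assoc using that(1) G_left[OF that(2) \<open>y \<in> ?G\<close>] by (rule ann)
    qed
    show "x \<bullet> y = 0" if "x \<in> span ?G" "y \<in> span ?G" for x y
      using that(1)
    proof (induction rule: span_induct)
      show "subspace {x. x \<bullet> y = 0}"
        by (rule lin) (auto simp: mult_add_left mult_scale_left)
      fix x assume x: "x \<in> ?G"
      show "x \<bullet> y = 0"
        using that(2)
      proof (induction rule: span_induct)
        show "subspace {y. x \<bullet> y = 0}"
          by (rule lin) (auto simp: mult_add_right mult_scale_right)
        show "x \<bullet> y = 0" if "y \<in> ?G" for y using x that by (rule 1)
      qed
    qed
  qed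
  then show ?thesis using span_superset[of ?G] by blast
qed

lemma left_ideal_right_multiples:
  assumes "left_ideal L" "x \<in> W"
  shows "left_ideal ((\<lambda>y. y \<bullet> x) ` L)"
proof -
  have "y \<bullet> x + z \<bullet> x \<in> (\<lambda>y. y \<bullet> x) ` L" if "y \<in> L" "z \<in> L" for y z
    using left_idealD(1)[OF assms(1)] that by (intro image_eqI[of _ _ "y + z"])
      (auto simp: mult_add_left subspace_add)
  moreover have "c *s (y \<bullet> x) \<in> (\<lambda>y. y \<bullet> x) ` L" if "y \<in> L" for c y
    using left_idealD(1)[OF assms(1)] that by (intro image_eqI[of _ _ "c *s y"])
      (auto simp: mult_scale_left subspace_scale)
  moreover have "w \<bullet> (y \<bullet> x) \<in> (\<lambda>y. y \<bullet> x) ` L" if "w \<in> W" "y \<in> L" for w y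
    using left_idealD(3)[OF assms(1) that] by (intro image_eqI[of _ _ "w \<bullet> y"]) (auto simp: mult_assoc)
  moreover have "0 \<in> (\<lambda>y. y \<bullet> x) ` L"
    using left_idealD(1)[OF assms(1)] by (intro image_eqI[of _ _ 0]) (auto simp: subspace_0)
  ultimately show ?thesis
    using assms by (auto simp: left_ideal_def subspace_def)
qed

lemma left_ideal_eigenspace:
  assumes "left_ideal L"
  shows "left_ideal {y \<in> L. y \<bullet> x = c *s y}"
  using assms
  by (auto simp: left_ideal_def subspace_def mult_add_left mult_scale_left mult_assoc mult_scale_right
      scale_right_distrib scale_left_commute)

lemma left_ideal_W: "left_ideal W"
  using subspace_W by (simp add: left_ideal_def)

text \<open>
  First \<open>W x\<close> is a square-zero left ideal, hence zero; but then the line through \<open>x\<close> is itself a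
  square-zero left ideal.
\<close>

lemma semiprime:
  assumes x: "x \<in> W" and sq: "\<And>w. w \<in> W \<Longrightarrow> x \<bullet> (w \<bullet> x) = 0"
  shows "x = 0"
proof -
  have "left_ideal ((\<lambda>w. w \<bullet> x) ` W)"
    using left_ideal_right_multiples left_ideal_W x by blast
  moreover have "a \<bullet> b = 0" if "a \<in> (\<lambda>w. w \<bullet> x) ` W" "b \<in> (\<lambda>w. w \<bullet> x) ` W" for a b
    using that sq by (auto simp: mult_assoc)
  ultimately have "(\<lambda>w. w \<bullet> x) ` W \<subseteq> {0}"
    using square_zero_left_ideal by blast
  then have 0: "w \<bullet> x = 0" if "w \<in> W" for w using that by blast
  have "left_ideal (span {x})"
    unfolding left_ideal_def
  proof (intro conjI ballI)
    show "span {x} \<subseteq> W" using span_minimal[of "{x}" W] x subspace_W by simp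
    show "w \<bullet> a \<in> span {x}" if "w \<in> W" "a \<in> span {x}" for w a
      using that 0 by (auto simp: span_singleton mult_scale_right intro: range_eqI[of _ _ 0])
  qed simp
  moreover have "a \<bullet> b = 0" if "a \<in> span {x}" "b \<in> span {x}" for a b
    using that 0 x by (auto simp: span_singleton mult_scale_right mult_scale_left)
  ultimately have "span {x} \<subseteq> {0}"
    using square_zero_left_ideal by blast
  then show ?thesis using span_base[of x "{x}"] by auto
qed

lemma minimal_left_ideal_exists:
  assumes "left_ideal C" "C \<noteq> {0}"
  obtains L where "left_ideal L" "L \<subseteq> C" "L \<noteq> {0}"
    "\<And>M. left_ideal M \<Longrightarrow> M \<subseteq> L \<Longrightarrow> M \<noteq> {0} \<Longrightarrow> M = L"
proof -
  let ?P = "\<lambda>L. left_ideal L \<and> L \<subseteq> C \<and> L \<noteq> {0}"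
  have "?P C" using assms by simp
  then obtain L where L: "?P L" "\<And>M. ?P M \<Longrightarrow> dim L \<le> dim M"
    using ex_has_least_nat[of ?P C dim] by blast
  have "M = L" if M: "left_ideal M" "M \<subseteq> L" "M \<noteq> {0}" for M
  proof (rule ccontr)
    assume "M \<noteq> L"
    then have "M \<subset> L" using M(2) by blast
    moreover have "L \<subseteq> span T" using left_idealD(2) L(1) W_span by blast
    ultimately have "dim M < dim L"
      using dim_strict_mono_in_finite_span[OF finite_T left_idealD(1)[OF M(1)]] by blast
    then show False using L(2)[of M] L(1) M by (meson leD subset_trans)
  qed
  then show ?thesis using that L(1) by blast
qed

end

locale split_semiprime_algebra = semiprime_algebra scale mult W T
  for scale :: "'k::alg_closed_field \<Rightarrow> 'v::ab_group_add \<Rightarrow> 'v" (infixr \<open>*s\<close> 75)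
    and mult :: "'v \<Rightarrow> 'v \<Rightarrow> 'v" (infixl \<open>\<bullet>\<close> 70) and W T
begin

text \<open>
  Brauer's lemma together with Schur's lemma. As \<open>L L \<noteq> 0\<close>, some right multiplication by \<open>x \<in> L\<close> maps
  \<open>L\<close> onto \<open>L\<close>, and it is injective by minimality; the preimage \<open>e\<close> of \<open>x\<close> is a right unit of
  \<open>L\<close>. Right multiplication by \<open>e w e\<close> has an eigenvector in \<open>L\<close>, the eigenspace is a left ideal,
  hence all of \<open>L\<close>, so that \<open>e w e\<close> is a multiple of \<open>e\<close>.
\<close>

lemma minimal_left_ideal_generator:
  assumes L: "left_ideal L" "L \<noteq> {0}"
    and minimal: "\<And>M. left_ideal M \<Longrightarrow> M \<subseteq> L \<Longrightarrow> M \<noteq> {0} \<Longrightarrow> M = L"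
  obtains e where "e \<in> L" "e \<noteq> 0" "\<And>y. y \<in> L \<Longrightarrow> y \<bullet> e = y"
    "\<And>w. w \<in> W \<Longrightarrow> \<exists>c. e \<bullet> (w \<bullet> e) = c *s e"
proof -
  have L0: "0 \<in> L" using L(1) left_idealD(1) subspace_0 by blast
  have "\<not> L \<subseteq> {0}" using L(2) L0 by blast
  then obtain x z where xz: "x \<in> L" "z \<in> L" "z \<bullet> x \<noteq> 0"
    using square_zero_left_ideal[OF L(1)] by blast
  have inL: "y \<in> W" if "y \<in> L" for y using left_idealD(2) L(1) that by blast
  have "(\<lambda>y. y \<bullet> x) ` L = L"
  proof (rule minimal)
    show "left_ideal ((\<lambda>y. y \<bullet> x) ` L)"
      using left_ideal_right_multiples L(1) xz inL by blast
    show "(\<lambda>y. y \<bullet> x) ` L \<subseteq> L" using left_idealD(3)[OF L(1)] inL xz by blast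
    show "(\<lambda>y. y \<bullet> x) ` L \<noteq> {0}" using xz by blast
  qed
  then obtain e where e: "e \<in> L" "e \<bullet> x = x" using xz(1) by (metis imageE)
  have "e \<noteq> 0" using e xz by auto
  have "{y \<in> L. y \<bullet> x = 0 *s y} = {0}"
  proof (rule ccontr)
    assume "{y \<in> L. y \<bullet> x = 0 *s y} \<noteq> {0}"
    then have "{y \<in> L. y \<bullet> x = 0 *s y} = L"
      by (intro minimal left_ideal_eigenspace L(1)) auto
    then show False using xz by auto
  qed
  moreover have "y \<bullet> e - y \<in> {y \<in> L. y \<bullet> x = 0 *s y}" if "y \<in> L" for y
    using that e left_idealD[OF L(1)] by (simp add: mult_diff_left mult_assoc subspace_diff)
  ultimately have right_unit: "y \<bullet> e = y" if "y \<in> L" for y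
    using that by fastforce
  have "\<exists>c. e \<bullet> (w \<bullet> e) = c *s e" if "w \<in> W" for w
  proof -
    let ?a = "e \<bullet> (w \<bullet> e)"
    have a: "?a \<in> L" using that e left_idealD(3)[OF L(1)] inL by blast
    obtain c y where cy: "y \<in> L" "y \<noteq> 0" "y \<bullet> ?a = c *s y"
    proof -
      have "\<exists>c. \<exists>y\<in>L. y \<noteq> 0 \<and> y \<bullet> ?a = c *s y"
      proof (rule eigenvector_exists[where f = "\<lambda>y. y \<bullet> ?a" and T = T and x = e])
        show "\<exists>c. poly q c = 0" if "degree q > 0" for q :: "'k poly"
          using alg_closed_imp_poly_has_root[OF that] by auto
        show "L \<subseteq> span T" using W_span inL by blast
        show "y \<bullet> ?a \<in> L" if "y \<in> L" for y
          using left_idealD(3)[OF L(1)] a that inL by blast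
      qed (use e \<open>e \<noteq> 0\<close> finite_T left_idealD(1)[OF L(1)] in
          \<open>auto simp: mult_add_left mult_scale_left\<close>)
      then show ?thesis using that by blast
    qed
    have "{y \<in> L. y \<bullet> ?a = c *s y} = L"
      by (intro minimal left_ideal_eigenspace L(1)) (use cy in auto)
    then have "e \<bullet> ?a = c *s e" using e by blast
    then have "e \<bullet> ?a = c *s e" by simp
    moreover have "e \<bullet> ?a = ?a" using right_unit[OF e(1)] by (simp add: mult_assoc[symmetric])
    ultimately show ?thesis by auto
  qed
  then show ?thesis using that e \<open>e \<noteq> 0\<close> right_unit by blast
qed

text \<open>
  The product of \<open>e W\<close> and \<open>W e\<close> lands in the line through \<open>e\<close>, so it is a bilinear pairing. No
  nonzero \<open>z\<close> in \<open>W e\<close> is orthogonal to \<open>e W\<close>: \<open>e W z = 0\<close> would force \<open>z W z = 0\<close>. A biorthogonal system of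
  maximal length therefore detects every \<open>z\<close>, since otherwise a Gram-Schmidt step would extend it.
\<close>

lemma biorthogonal_system:
  assumes e: "e \<in> W" "e \<noteq> 0" "e \<bullet> e = e"
    and corner: "\<forall>w\<in>W. \<exists>c. e \<bullet> (w \<bullet> e) = c *s e"
  shows "\<exists>(n :: nat) x y. (\<forall>i<n. (x i \<in> W \<and> x i \<bullet> e = x i) \<and> (y i \<in> W \<and> e \<bullet> y i = y i)) \<and>
    (\<forall>i<n. \<forall>j<n. y i \<bullet> x j = (if i = j then e else 0)) \<and>
    (\<forall>z. z \<in> W \<longrightarrow> z \<bullet> e = z \<longrightarrow> (\<forall>i<n. y i \<bullet> z = 0) \<longrightarrow> z = 0)"
proof -
  let ?X = "\<lambda>z. z \<in> W \<and> z \<bullet> e = z" and ?Y = "\<lambda>z. z \<in> W \<and> e \<bullet> z = z"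
  define P where "P n \<longleftrightarrow> (\<exists>x y. (\<forall>i<n. ?X (x i) \<and> ?Y (y i)) \<and>
    (\<forall>i<n. \<forall>j<n. y i \<bullet> x j = (if i = j then e else 0)))" for n :: nat
  have corner': "\<exists>c. y \<bullet> x = c *s e" if "?Y y" "?X x" for x y
  proof -
    have "e \<bullet> (y \<bullet> x \<bullet> e) = (e \<bullet> y) \<bullet> (x \<bullet> e)" by (simp only: mult_assoc)
    then show ?thesis using bspec[OF corner, of "y \<bullet> x"] that by simp
  qed
  have bound: "n \<le> card T" if "P n" for n
  proof (rule ccontr)
    assume n: "\<not> n \<le> card T"
    from that obtain x y where xy: "\<forall>i<n. ?X (x i) \<and> ?Y (y i)"
      "\<forall>i<n. \<forall>j<n. y i \<bullet> x j = (if i = j then e else 0)" unfolding P_def by blast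
    have "x i \<in> span T" if "i \<le> card T" for i using xy(1) W_span n that by auto
    then obtain c i where c: "i \<le> card T" "c i \<noteq> 0" "(\<Sum>j\<le>card T. c j *s x j) = 0"
      using nontrivial_relation_in_finite_span[OF finite_T, of x] by blast
    have "0 = y i \<bullet> (\<Sum>j\<le>card T. c j *s x j)" by (simp add: c)
    also have "\<dots> = (\<Sum>j\<le>card T. if j = i then c i *s e else 0)"
      unfolding mult_sum_right by (rule sum.cong) (use xy(2) n c(1) in \<open>auto simp: mult_scale_right\<close>)
    also have "\<dots> = c i *s e" using c(1) by simp
    finally show False using c(2) e(2) by simp
  qed
  have "P 0" by (simp add: P_def)
  then obtain n where n: "P n" "\<And>m. P m \<Longrightarrow> m \<le> n"
    using bound Nat.ex_has_greatest_nat[of P 0 "card T"] by blast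
  then obtain x y where xy: "\<forall>i<n. ?X (x i) \<and> ?Y (y i)"
      "\<forall>i<n. \<forall>j<n. y i \<bullet> x j = (if i = j then e else 0)" unfolding P_def by blast
  have "z = 0" if z: "?X z" "\<And>i. i < n \<Longrightarrow> y i \<bullet> z = 0" for z
  proof (rule ccontr)
    assume "z \<noteq> 0"
    have "\<exists>w\<in>W. e \<bullet> (w \<bullet> z) \<noteq> 0"
    proof (rule ccontr)
      assume "\<not> ?thesis"
      then have "z \<bullet> (w \<bullet> z) = 0" if "w \<in> W" for w
        using z(1) that by (metis mult_assoc mult_null_right)
      then show False using semiprime z(1) \<open>z \<noteq> 0\<close> by blast
    qed
    then obtain w where w: "w \<in> W" "e \<bullet> (w \<bullet> z) \<noteq> 0" by blast
    have Yw: "?Y (e \<bullet> w)" using w e by (simp add: mult_assoc[symmetric])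
    obtain c where c: "e \<bullet> w \<bullet> z = c *s e" using corner'[OF Yw z(1)] by blast
    then have "c \<noteq> 0" using w by (auto simp: mult_assoc)
    have "\<exists>d. e \<bullet> w \<bullet> x i = d *s e" if "i < n" for i
      using corner'[OF Yw] xy(1) that by blast
    then obtain d where d: "\<And>i. i < n \<Longrightarrow> e \<bullet> w \<bullet> x i = d i *s e" by metis
    \<comment> \<open>subtracting the components along the old system makes the new functional orthogonal to it\<close>
    define v where "v = inverse c *s (e \<bullet> w - (\<Sum>i<n. d i *s y i))"
    have "v \<in> W" unfolding v_def using Yw xy(1) e(1) w(1) by (intro W_closed W_sum) auto
    moreover have "e \<bullet> (\<Sum>i<n. d i *s y i) = (\<Sum>i<n. d i *s y i)"
      unfolding mult_sum_right by (rule sum.cong) (use xy(1) in \<open>auto simp: mult_scale_right\<close>)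
    then have "e \<bullet> v = v" using Yw by (simp add: v_def mult_diff_right mult_scale_right)
    ultimately have Yv: "?Y v" by blast
    have "v \<bullet> z = e" using c z(2) \<open>c \<noteq> 0\<close>
      by (simp add: v_def mult_diff_left mult_scale_left mult_sum_left)
    moreover have "v \<bullet> x j = 0" if "j < n" for j
    proof -
      have "(\<Sum>i<n. d i *s y i) \<bullet> x j = (\<Sum>i<n. if i = j then d j *s e else 0)"
        unfolding mult_sum_left by (rule sum.cong) (use xy(2) that in \<open>auto simp: mult_scale_left\<close>)
      then show ?thesis using d that by (simp add: v_def mult_diff_left mult_scale_left)
    qed
    ultimately have "P (Suc n)"
      unfolding P_def using xy z Yv
      by (intro exI[of _ "x(n := z)"] exI[of _ "y(n := v)"]) (auto simp: less_Suc_eq)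
    then show False using n(2) by fastforce
  qed
  then show ?thesis using xy by (intro exI[of _ n] exI[of _ x] exI[of _ y]) simp
qed

definition bilinear_form :: "('v \<Rightarrow> 'v \<Rightarrow> 'k) \<Rightarrow> bool" where
  "bilinear_form \<beta> \<longleftrightarrow>
    (\<forall>x y z. \<beta> (x + y) z = \<beta> x z + \<beta> y z \<and> \<beta> x (y + z) = \<beta> x y + \<beta> x z) \<and>
    (\<forall>c x y. \<beta> (c *s x) y = c * \<beta> x y \<and> \<beta> x (c *s y) = c * \<beta> x y)"

text \<open>
  A list of pairs stands for the sum of the tensors \<open>x \<otimes> y\<close>, and two tensors are equal if all
  bilinear forms agree on them; so this says that \<open>a\<close> times the tensor is the tensor times \<open>a\<close>.
\<close>

definition invariant_tensor :: "('v \<times> 'v) list \<Rightarrow> bool" where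
  "invariant_tensor ts \<longleftrightarrow> set ts \<subseteq> W \<times> W \<and> (\<forall>a\<in>W. \<forall>\<beta>. bilinear_form \<beta> \<longrightarrow>
    (\<Sum>(x, y)\<leftarrow>ts. \<beta> (a \<bullet> x) y) = (\<Sum>(x, y)\<leftarrow>ts. \<beta> x (y \<bullet> a)))"

definition contraction :: "('v \<times> 'v) list \<Rightarrow> 'v" where
  "contraction ts = (\<Sum>(x, y)\<leftarrow>ts. x \<bullet> y)"

lemma invariant_tensorD:
  assumes "invariant_tensor ts"
  shows "set ts \<subseteq> W \<times> W"
    "a \<in> W \<Longrightarrow> bilinear_form \<beta> \<Longrightarrow>
      (\<Sum>(x, y)\<leftarrow>ts. \<beta> (a \<bullet> x) y) = (\<Sum>(x, y)\<leftarrow>ts. \<beta> x (y \<bullet> a))"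
  by (rule conjunct1[OF assms[unfolded invariant_tensor_def]],
      rule conjunct2[OF assms[unfolded invariant_tensor_def], THEN bspec, THEN spec, THEN mp])

lemma invariant_tensor_append:
  assumes "invariant_tensor ts" "invariant_tensor ts'"
  shows "invariant_tensor (ts @ ts')"
  unfolding invariant_tensor_def
proof (intro conjI ballI allI impI)
  show "set (ts @ ts') \<subseteq> W \<times> W"
    using invariant_tensorD(1)[OF assms(1)] invariant_tensorD(1)[OF assms(2)] by simp
  show "(\<Sum>(x, y)\<leftarrow>ts @ ts'. \<beta> (a \<bullet> x) y) = (\<Sum>(x, y)\<leftarrow>ts @ ts'. \<beta> x (y \<bullet> a))"
    if "a \<in> W" "bilinear_form \<beta>" for a \<beta>
    unfolding map_append sum_list_append
    by (rule arg_cong2[of _ _ _ _ "(+)"]) (rule invariant_tensorD(2)[OF _ that], fact assms)+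
qed

lemma bilinear_form_sum:
  assumes "bilinear_form \<beta>"
  shows "\<beta> (\<Sum>i\<in>A. c i *s f i) z = (\<Sum>i\<in>A. c i * \<beta> (f i) z)"
    "\<beta> z (\<Sum>i\<in>A. c i *s f i) = (\<Sum>i\<in>A. c i * \<beta> z (f i))"
proof -
  have "\<beta> 0 z = 0" "\<beta> z 0 = 0"
    using assms[unfolded bilinear_form_def, THEN conjunct2, rule_format, of 0] by force+
  then show "\<beta> (\<Sum>i\<in>A. c i *s f i) z = (\<Sum>i\<in>A. c i * \<beta> (f i) z)"
    "\<beta> z (\<Sum>i\<in>A. c i *s f i) = (\<Sum>i\<in>A. c i * \<beta> z (f i))"
    using assms unfolding bilinear_form_def
    by (induction A rule: infinite_finite_induct) simp_all
qed

text \<open>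
  The Casimir element of the simple component containing a minimal left ideal \<open>W e\<close>. With
  dual bases \<open>x i\<close> of \<open>W e\<close> and \<open>y i\<close> of \<open>e W\<close>, left multiplication by \<open>a\<close> on the \<open>x i\<close> and right
  multiplication by \<open>a\<close> on the \<open>y i\<close> are given by transposed matrices \<open>\<alpha>\<close>, and this makes
  \<open>\<Sum> x i \<otimes> y i\<close> invariant and its product central.
\<close>

lemma central_idempotent_in_ideal:
  assumes C: "left_ideal C" "C \<noteq> {0}" and C_right: "\<And>x w. x \<in> C \<Longrightarrow> w \<in> W \<Longrightarrow> x \<bullet> w \<in> C"
  shows "\<exists>ts e. invariant_tensor ts \<and> contraction ts \<in> C \<and>
    (\<forall>a\<in>W. a \<bullet> contraction ts = contraction ts \<bullet> a) \<and>
    contraction ts \<bullet> contraction ts = contraction ts \<and>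
    e \<in> C \<and> e \<noteq> 0 \<and> contraction ts \<bullet> e = e"
proof -
  obtain L where L: "left_ideal L" "L \<subseteq> C" "L \<noteq> {0}"
    "\<And>M. left_ideal M \<Longrightarrow> M \<subseteq> L \<Longrightarrow> M \<noteq> {0} \<Longrightarrow> M = L"
    using minimal_left_ideal_exists[OF C] by blast
  obtain e where e: "e \<in> L" "e \<noteq> 0" "\<And>y. y \<in> L \<Longrightarrow> y \<bullet> e = y"
    "\<And>w. w \<in> W \<Longrightarrow> \<exists>c. e \<bullet> (w \<bullet> e) = c *s e"
    using minimal_left_ideal_generator[OF L(1,3,4)] by blast
  have eC: "e \<in> C" and eW: "e \<in> W" and ee: "e \<bullet> e = e"
    using e L(2) left_idealD(2)[OF L(1)] by auto
  have corner: "\<forall>w\<in>W. \<exists>c. e \<bullet> (w \<bullet> e) = c *s e" using e(4) by blast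
  obtain n :: nat and x y where
    xy: "\<forall>i<n. (x i \<in> W \<and> x i \<bullet> e = x i) \<and> (y i \<in> W \<and> e \<bullet> y i = y i)" and
    yx': "\<forall>i<n. \<forall>j<n. y i \<bullet> x j = (if i = j then e else 0)" and
    total': "\<forall>z. z \<in> W \<longrightarrow> z \<bullet> e = z \<longrightarrow> (\<forall>i<n. y i \<bullet> z = 0) \<longrightarrow> z = 0"
    using biorthogonal_system[OF eW e(2) ee corner] by (elim exE conjE)
  have x: "x i \<in> W" "x i \<bullet> e = x i" and y: "y i \<in> W" "e \<bullet> y i = y i" if "i < n" for i
    using xy that by simp_all
  have yx: "y i \<bullet> x j = (if i = j then e else 0)" if "i < n" "j < n" for i j
    using yx' that by simp
  have total: "z = 0" if "z \<in> W" "z \<bullet> e = z" "\<And>i. i < n \<Longrightarrow> y i \<bullet> z = 0" for z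
    using total' that by simp
  have pick: "(\<Sum>j<n. if i = j then f j else 0) = f i" if "i < n" for i and f :: "nat \<Rightarrow> 'v"
    using that by simp
  have expand: "z = (\<Sum>i<n. c i *s x i)"
    if z: "z \<in> W" "z \<bullet> e = z" and c: "\<And>i. i < n \<Longrightarrow> y i \<bullet> z = c i *s e" for z c
  proof -
    have "z - (\<Sum>i<n. c i *s x i) = 0"
    proof (rule total)
      show "z - (\<Sum>i<n. c i *s x i) \<in> W" using z x by (intro W_closed W_sum) auto
      show "(z - (\<Sum>i<n. c i *s x i)) \<bullet> e = z - (\<Sum>i<n. c i *s x i)"
        using z x by (simp add: mult_diff_left mult_sum_left mult_scale_left)
      fix i assume i: "i < n"
      have "y i \<bullet> (\<Sum>j<n. c j *s x j) = (\<Sum>j<n. if i = j then c j *s e else 0)"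
        unfolding mult_sum_right by (rule sum.cong) (use yx i in \<open>auto simp: mult_scale_right\<close>)
      also have "\<dots> = c i *s e" using i by (rule pick)
      finally show "y i \<bullet> (z - (\<Sum>i<n. c i *s x i)) = 0"
        using c i by (simp add: mult_diff_right)
    qed
    then show ?thesis by simp
  qed
  have coeffs: "\<exists>c. y i \<bullet> z = c *s e" if "i < n" "z \<in> W" "z \<bullet> e = z" for i z
  proof -
    have "e \<bullet> (y i \<bullet> z \<bullet> e) = (e \<bullet> y i) \<bullet> (z \<bullet> e)" by (simp only: mult_assoc)
    then show ?thesis using e(4)[of "y i \<bullet> z"] y[OF that(1)] that by simp
  qed
  have spanX: "\<exists>c. z = (\<Sum>i<n. c i *s x i)" if "z \<in> W" "z \<bullet> e = z" for z
  proof -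
    have c: "y i \<bullet> z = (SOME d. y i \<bullet> z = d *s e) *s e" if "i < n" for i
      using someI_ex[OF coeffs[OF that \<open>z \<in> W\<close> \<open>z \<bullet> e = z\<close>]] .
    show ?thesis
      by (rule exI, rule expand[OF that c])
  qed
  \<comment> \<open>the pairing is nondegenerate on the other side, too\<close>
  have faithful: "w = 0" if w: "w \<in> W" "e \<bullet> w = w" "\<And>j. j < n \<Longrightarrow> w \<bullet> x j = 0" for w
  proof (rule semiprime[OF w(1)])
    have wX: "w \<bullet> z = 0" if z: "z \<in> W" "z \<bullet> e = z" for z
    proof -
      obtain c where "z = (\<Sum>i<n. c i *s x i)" using spanX z by blast
      then show ?thesis using w(3) by (simp add: mult_sum_right mult_scale_right)
    qed
    fix v assume "v \<in> W"
    then have "w \<bullet> (v \<bullet> e) = 0" using eW ee by (intro wX) (auto simp: mult_assoc)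
    then have "w \<bullet> (v \<bullet> e) \<bullet> w = 0" by simp
    then show "w \<bullet> (v \<bullet> w) = 0" by (simp add: mult_assoc w(2))
  qed
  have matrix: "\<exists>\<alpha>. (\<forall>j<n. a \<bullet> x j = (\<Sum>i<n. \<alpha> i j *s x i)) \<and>
      (\<forall>i<n. y i \<bullet> a = (\<Sum>j<n. \<alpha> i j *s y j))" if a: "a \<in> W" for a
  proof -
    have "\<exists>c. y i \<bullet> (a \<bullet> x j) = c *s e" if "i < n" "j < n" for i j
      using coeffs[OF that(1), of "a \<bullet> x j"] a x that by (simp add: mult_assoc)
    then have "y i \<bullet> (a \<bullet> x j) = (SOME d. y i \<bullet> (a \<bullet> x j) = d *s e) *s e" if "i < n" "j < n" for i j
      using someI_ex[of "\<lambda>d. y i \<bullet> (a \<bullet> x j) = d *s e"] that by blast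
    then obtain \<alpha> where \<alpha>: "\<And>i j. i < n \<Longrightarrow> j < n \<Longrightarrow> y i \<bullet> (a \<bullet> x j) = \<alpha> i j *s e"
      by (rule that[of "\<lambda>i j. SOME d. y i \<bullet> (a \<bullet> x j) = d *s e"])
    have "a \<bullet> x j = (\<Sum>i<n. \<alpha> i j *s x i)" if "j < n" for j
      using that a x \<alpha> by (intro expand) (auto simp: mult_assoc)
    moreover have "y i \<bullet> a = (\<Sum>j<n. \<alpha> i j *s y j)" if i: "i < n" for i
    proof -
      have "y i \<bullet> a - (\<Sum>j<n. \<alpha> i j *s y j) = 0"
      proof (rule faithful)
        show "y i \<bullet> a - (\<Sum>j<n. \<alpha> i j *s y j) \<in> W" using y a i by (intro W_closed W_sum) auto
        show "e \<bullet> (y i \<bullet> a - (\<Sum>j<n. \<alpha> i j *s y j)) = y i \<bullet> a - (\<Sum>j<n. \<alpha> i j *s y j)"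
          using y i by (simp add: mult_diff_right mult_sum_right mult_scale_right mult_assoc[symmetric])
        fix k assume k: "k < n"
        have "(\<Sum>j<n. \<alpha> i j *s y j) \<bullet> x k = (\<Sum>j<n. if k = j then \<alpha> i j *s e else 0)"
          unfolding mult_sum_left by (rule sum.cong) (use yx k in \<open>auto simp: mult_scale_left\<close>)
        also have "\<dots> = \<alpha> i k *s e" using k by (rule pick)
        finally show "(y i \<bullet> a - (\<Sum>j<n. \<alpha> i j *s y j)) \<bullet> x k = 0"
          using \<alpha> i k by (simp add: mult_diff_left mult_assoc)
      qed
      then show ?thesis by simp
    qed
    ultimately show ?thesis by blast
  qed
  define u where "u = (\<Sum>i<n. x i \<bullet> y i)"
  define ts where "ts = map (\<lambda>i. (x i, y i)) [0..<n]"
  have ts_sum: "(\<Sum>(v, w)\<leftarrow>ts. g v w) = (\<Sum>i<n. g (x i) (y i))" for g :: "'v \<Rightarrow> 'v \<Rightarrow> 'c::comm_monoid_add"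
    by (simp add: ts_def comp_def interv_sum_list_conv_sum_set_nat atLeast0LessThan)
  have inv: "invariant_tensor ts"
    unfolding invariant_tensor_def
  proof (intro conjI ballI allI impI)
    show "set ts \<subseteq> W \<times> W" using x y by (auto simp: ts_def)
    fix a \<beta> assume a: "a \<in> W" and \<beta>: "bilinear_form \<beta>"
    obtain \<alpha> where \<alpha>: "\<forall>j<n. a \<bullet> x j = (\<Sum>i<n. \<alpha> i j *s x i)" "\<forall>i<n. y i \<bullet> a = (\<Sum>j<n. \<alpha> i j *s y j)"
      using matrix[OF a] by blast
    have "(\<Sum>j<n. \<beta> (a \<bullet> x j) (y j)) = (\<Sum>j<n. \<Sum>i<n. \<alpha> i j * \<beta> (x i) (y j))"
      by (rule sum.cong) (simp_all add: \<alpha> bilinear_form_sum[OF \<beta>])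
    also have "\<dots> = (\<Sum>i<n. \<Sum>j<n. \<alpha> i j * \<beta> (x i) (y j))" by (rule sum.swap)
    also have "\<dots> = (\<Sum>i<n. \<beta> (x i) (y i \<bullet> a))"
      by (rule sum.cong) (simp_all add: \<alpha> bilinear_form_sum[OF \<beta>])
    finally show "(\<Sum>(x, y)\<leftarrow>ts. \<beta> (a \<bullet> x) y) = (\<Sum>(x, y)\<leftarrow>ts. \<beta> x (y \<bullet> a))"
      by (simp add: ts_sum)
  qed
  have u_eq: "contraction ts = u" unfolding contraction_def u_def by (rule ts_sum)
  have uC: "u \<in> C"
  proof -
    have "y i \<in> C" if "i < n" for i using C_right[OF eC, of "y i"] y that by simp
    then show ?thesis unfolding u_def
      using left_idealD(1,3)[OF C(1)] x by (intro subspace_sum) auto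
  qed
  have comm: "a \<bullet> u = u \<bullet> a" if a: "a \<in> W" for a
  proof -
    obtain \<alpha> where \<alpha>: "\<forall>j<n. a \<bullet> x j = (\<Sum>i<n. \<alpha> i j *s x i)" "\<forall>i<n. y i \<bullet> a = (\<Sum>j<n. \<alpha> i j *s y j)"
      using matrix[OF a] by blast
    have "a \<bullet> u = (\<Sum>j<n. \<Sum>i<n. \<alpha> i j *s (x i \<bullet> y j))"
      unfolding u_def mult_sum_right
      by (rule sum.cong) (simp_all add: \<alpha> mult_assoc[symmetric] mult_sum_left mult_scale_left)
    also have "\<dots> = (\<Sum>i<n. \<Sum>j<n. \<alpha> i j *s (x i \<bullet> y j))" by (rule sum.swap)
    also have "\<dots> = u \<bullet> a"
      unfolding u_def mult_sum_left
      by (rule sum.cong) (simp_all add: \<alpha> mult_assoc mult_sum_right mult_scale_right)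
    finally show ?thesis .
  qed
  have ux: "u \<bullet> x j = x j" if j: "j < n" for j
  proof -
    have "u \<bullet> x j = (\<Sum>i<n. if j = i then x i else 0)"
      unfolding u_def mult_sum_left by (rule sum.cong) (use yx j x in \<open>auto simp: mult_assoc\<close>)
    also have "\<dots> = x j" using j by (rule pick)
    finally show ?thesis .
  qed
  have "u \<bullet> u = (\<Sum>i<n. (u \<bullet> x i) \<bullet> y i)"
    by (simp add: u_def[symmetric] mult_assoc mult_sum_right[symmetric])
  then have uu: "u \<bullet> u = u" by (simp add: ux u_def[symmetric])
  have ue: "u \<bullet> e = e"
  proof -
    obtain c where "e = (\<Sum>i<n. c i *s x i)" using spanX[OF eW ee] by blast
    then show ?thesis using ux by (simp add: mult_sum_right mult_scale_right)
  qed
  show ?thesis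
  proof (intro exI[of _ ts] exI[of _ e] conjI ballI)
    show "a \<bullet> contraction ts = contraction ts \<bullet> a" if "a \<in> W" for a
      unfolding u_eq using that by (rule comm)
  qed (simp_all only: u_eq inv uC uu eC e(2) ue not_False_eq_True)
qed

text \<open>
  Choose an invariant tensor, with central idempotent product \<open>u\<close>, whose annihilator ideal is as
  small as possible. A nonzero annihilator contains a further such tensor by the preceding lemma, and adding it
  makes the annihilator smaller. So the annihilator is zero, and it contains all \<open>u a - a\<close>.
\<close>

theorem separability_tensor_exists:
  obtains ts where "invariant_tensor ts" "\<And>a. a \<in> W \<Longrightarrow> contraction ts \<bullet> a = a"
proof -
  let ?C = "\<lambda>u. {a \<in> W. u \<bullet> a = 0}"
  define P where "P ts \<longleftrightarrow> invariant_tensor ts \<and> contraction ts \<in> W \<and>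
    (\<forall>a\<in>W. a \<bullet> contraction ts = contraction ts \<bullet> a) \<and>
    contraction ts \<bullet> contraction ts = contraction ts" for ts
  have "P []" by (simp add: P_def invariant_tensor_def contraction_def)
  then have "\<exists>ts. P ts \<and> (\<forall>ts'. P ts' \<longrightarrow> dim (?C (contraction ts)) \<le> dim (?C (contraction ts')))"
    by (rule ex_has_least_nat)
  then obtain ts where ts: "P ts"
    and least: "\<forall>ts'. P ts' \<longrightarrow> dim (?C (contraction ts)) \<le> dim (?C (contraction ts'))"
    by (elim exE conjE)
  define u where "u = contraction ts"
  have u': "u \<in> W" "\<forall>a\<in>W. a \<bullet> u = u \<bullet> a" "u \<bullet> u = u"
    using ts unfolding P_def u_def by - (elim conjE, assumption)+
  have u: "u \<in> W" "a \<in> W \<Longrightarrow> a \<bullet> u = u \<bullet> a" "u \<bullet> u = u" for a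
    by (fact u'(1), erule bspec[OF u'(2)], fact u'(3))
  have "?C u = {0}"
  proof (rule ccontr)
    assume ne: "?C u \<noteq> {0}"
    have sub: "subspace (?C v)" for v
      by (auto simp: subspace_def mult_add_right mult_scale_right)
    have ideal: "left_ideal (?C u)"
      unfolding left_ideal_def
    proof (intro conjI ballI sub)
      fix w x assume wx: "w \<in> W" "x \<in> ?C u"
      have "u \<bullet> (w \<bullet> x) = w \<bullet> (u \<bullet> x)"
        using u(2)[OF wx(1)] by (simp only: mult_assoc[symmetric])
      then show "w \<bullet> x \<in> ?C u" using wx by simp
    qed blast
    have right: "x \<bullet> w \<in> ?C u" if "x \<in> ?C u" "w \<in> W" for x w
      using that by (simp add: mult_assoc[symmetric])
    have "\<exists>ts' e. invariant_tensor ts' \<and> contraction ts' \<in> ?C u \<and>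
      (\<forall>a\<in>W. a \<bullet> contraction ts' = contraction ts' \<bullet> a) \<and>
      contraction ts' \<bullet> contraction ts' = contraction ts' \<and>
      e \<in> ?C u \<and> e \<noteq> 0 \<and> contraction ts' \<bullet> e = e"
      using ideal ne right by (rule central_idempotent_in_ideal)
    then obtain ts' e where ts': "invariant_tensor ts'" "contraction ts' \<in> ?C u"
      "\<forall>a\<in>W. a \<bullet> contraction ts' = contraction ts' \<bullet> a"
      "contraction ts' \<bullet> contraction ts' = contraction ts'"
      "e \<in> ?C u" "e \<noteq> 0" "contraction ts' \<bullet> e = e"
      by (elim exE conjE)
    define v where "v = contraction ts'"
    have uv: "contraction (ts @ ts') = u + v" by (simp add: contraction_def u_def v_def)
    have v: "v \<in> W" "u \<bullet> v = 0" "v \<bullet> v = v"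
      using ts'(2,4) by (simp_all add: v_def)
    have v_comm: "a \<bullet> v = v \<bullet> a" if "a \<in> W" for a
      unfolding v_def using ts'(3) that by (rule bspec)
    have vu: "v \<bullet> u = 0" using u(2)[OF v(1)] v(2) by simp
    have "P (ts @ ts')"
      unfolding P_def uv
    proof (intro conjI ballI)
      show "invariant_tensor (ts @ ts')"
        using ts[unfolded P_def, THEN conjunct1] ts'(1) by (rule invariant_tensor_append)
      show "u + v \<in> W" using u(1) v(1) by simp
      show "a \<bullet> (u + v) = (u + v) \<bullet> a" if "a \<in> W" for a
        unfolding mult_add_left mult_add_right u(2)[OF that] v_comm[OF that] ..
      show "(u + v) \<bullet> (u + v) = u + v"
        by (simp add: mult_add_left mult_add_right u(3) v(2,3) vu)
    qed
    moreover have "?C (u + v) \<subset> ?C u"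
    proof
      show "?C (u + v) \<subseteq> ?C u"
      proof
        fix a assume "a \<in> ?C (u + v)"
        then have "a \<in> W" "u \<bullet> ((u + v) \<bullet> a) = 0" by auto
        then show "a \<in> ?C u" using u(3) v(2) by (simp add: mult_assoc[symmetric] mult_add_right)
      qed
      have "(u + v) \<bullet> e \<noteq> 0" using ts'(5-7) by (simp add: mult_add_left v_def)
      then show "?C (u + v) \<noteq> ?C u" using ts'(5) by blast
    qed
    then have "dim (?C (u + v)) < dim (?C u)"
      using dim_strict_mono_in_finite_span[OF finite_T sub] W_span by blast
    ultimately show False using least[rule_format, of "ts @ ts'"] by (simp add: uv u_def[symmetric])
  qed
  moreover have "u \<bullet> a - a \<in> ?C u" if "a \<in> W" for a
    using that u(1,3) by (simp add: mult_diff_right mult_assoc[symmetric])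
  ultimately have "u \<bullet> a = a" if "a \<in> W" for a using that by fastforce
  then show ?thesis using that ts unfolding P_def u_def by blast
qed

end

section \<open>Subspaces, ideals and quotients of algebra records\<close>

text \<open>
  Both \<open>algebra_of_type\<close> and the free algebra in the definition of a scalar extension have addition,
  zero and scalars of a type; this is their common form, so that their subspaces,
  ideals and quotients need to be described only once.
\<close>

definition concrete_algebra ::
    "'v::ab_group_add set \<Rightarrow> ('v \<Rightarrow> 'v \<Rightarrow> 'v) \<Rightarrow> ('k \<Rightarrow> 'v \<Rightarrow> 'v) \<Rightarrow> ('k, 'v) module" where
  "concrete_algebra U mu sc =
    \<lparr>carrier = U, monoid.mult = mu, one = 0, ring.zero = 0, add = (+), module.smult = sc\<rparr>"

lemma concrete_algebra_simps [simp]: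
  "carrier (concrete_algebra U mu sc) = U"
  "monoid.mult (concrete_algebra U mu sc) = mu"
  "ring.zero (concrete_algebra U mu sc) = 0"
  "add (concrete_algebra U mu sc) = (+)"
  "module.smult (concrete_algebra U mu sc) = sc"
  by (simp_all add: concrete_algebra_def)

lemma ring_of_type_algebra_simps [simp]:
  "carrier (ring_of_type_algebra :: 'k::field ring) = UNIV"
  "monoid.mult (ring_of_type_algebra :: 'k ring) = (*)"
  "one (ring_of_type_algebra :: 'k ring) = 1"
  "ring.zero (ring_of_type_algebra :: 'k ring) = 0"
  "add (ring_of_type_algebra :: 'k ring) = (+)"
  by (simp_all add: ring_of_type_algebra_def fun_eq_iff)

lemma finsum_ring_of_type_algebra:
  assumes "finite A"
  shows "finsum (ring_of_type_algebra :: 'k::field ring) f A = sum f A"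
proof -
  have am: "abelian_monoid (ring_of_type_algebra :: 'k ring)"
    using ring.is_abelian_group[OF ring_from_type_algebra] by (rule abelian_group.axioms)
  show ?thesis
    using assms
  proof (induction A)
    case empty
    then show ?case using abelian_monoid.finsum_empty[OF am] by simp
  next
    case (insert x A)
    then show ?case using abelian_monoid.finsum_insert[OF am insert.hyps] by simp
  qed
qed

context vector_space
begin

lemma a_inv_concrete_algebra:
  assumes "subspace U" "x \<in> U"
  shows "a_inv (concrete_algebra U mu scale) x = - x"
    "m_inv (add_monoid (concrete_algebra U mu scale)) x = - x"
proof -
  have "(THE y. y \<in> U \<and> x + y = 0 \<and> y + x = 0) = - x"
    using assms subspace_neg by (intro the_equality) (auto dest: add.inverse_unique)
  then show "m_inv (add_monoid (concrete_algebra U mu scale)) x = - x"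
    by (simp add: m_inv_def)
  then show "a_inv (concrete_algebra U mu scale) x = - x"
    by (simp add: a_inv_def)
qed

lemma submodule_concrete_algebra_iff:
  assumes U: "subspace U"
  shows "submodule H ring_of_type_algebra (concrete_algebra U mu scale) \<longleftrightarrow> H \<subseteq> U \<and> subspace H"
proof
  assume "submodule H ring_of_type_algebra (concrete_algebra U mu scale)"
  then show "H \<subseteq> U \<and> subspace H"
    by (auto simp: submodule_def submodule_axioms_def subgroup_def subspace_def)
next
  assume H: "H \<subseteq> U \<and> subspace H"
  then show "submodule H ring_of_type_algebra (concrete_algebra U mu scale)"
    using a_inv_concrete_algebra(2)[OF U, of _ mu] subspace_neg[of H]
    by (auto simp: submodule_def submodule_axioms_def subgroup_def subspace_0 subspace_add subspace_scale subset_iff)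
qed

lemma is_left_ideal_concrete_algebra_iff:
  assumes "subspace U"
  shows "is_left_ideal ring_of_type_algebra (concrete_algebra U mu scale) I \<longleftrightarrow>
    I \<subseteq> U \<and> subspace I \<and> (\<forall>a\<in>U. \<forall>x\<in>I. mu a x \<in> I)"
  using assms by (simp add: is_left_ideal_def submodule_concrete_algebra_iff conj_assoc)

end

text \<open>
  There are two instances: the given algebra modulo its radical, and the free algebra modulo the
  subspace spanned by the tensor relations, which is the scalar extension.
\<close>

locale quotient_by_ideal = vector_space scale
  for scale :: "'k::field \<Rightarrow> 'v::ab_group_add \<Rightarrow> 'v" (infixr \<open>*s\<close> 75) +
  fixes mu :: "'v \<Rightarrow> 'v \<Rightarrow> 'v" and U H :: "'v set"
  assumes subspace_U: "subspace U" and subspace_H: "subspace H" and H_subset: "H \<subseteq> U"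
    and mu_closed: "x \<in> U \<Longrightarrow> y \<in> U \<Longrightarrow> mu x y \<in> U"
    and mu_cong: "\<lbrakk>x \<in> U; y \<in> U; x' \<in> U; y' \<in> U; x' - x \<in> H; y' - y \<in> H\<rbrakk> \<Longrightarrow> mu x' y' - mu x y \<in> H"
begin

definition cl :: "'v \<Rightarrow> 'v set" where "cl x = {y. y - x \<in> H}"

abbreviation "Q \<equiv> quotient_algebra (concrete_algebra U mu scale) H"

lemma cl_eq_iff: "cl x = cl y \<longleftrightarrow> x - y \<in> H"
proof
  assume "cl x = cl y"
  moreover have "x \<in> cl x" using subspace_H by (simp add: cl_def subspace_0)
  ultimately show "x - y \<in> H" by (simp add: cl_def)
next
  assume xy: "x - y \<in> H"
  have "z - x \<in> H \<longleftrightarrow> z - y \<in> H" for z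
  proof
    assume "z - x \<in> H"
    from subspace_add[OF subspace_H this xy] show "z - y \<in> H" by simp
  next
    assume "z - y \<in> H"
    from subspace_diff[OF subspace_H this xy] show "z - x \<in> H" by simp
  qed
  then show "cl x = cl y" by (simp add: cl_def)
qed

lemma cl_self: "x \<in> cl x"
  using subspace_H by (simp add: cl_def subspace_0)

lemma cl_subset: "x \<in> U \<Longrightarrow> y \<in> cl x \<Longrightarrow> y \<in> U"
  using H_subset subspace_add[OF subspace_U, of "y - x" x] by (auto simp: cl_def)

lemma rcoset_eq: "(\<Union>h\<in>H. {h + x}) = cl x"
proof (intro equalityI subsetI)
  fix y assume "y \<in> cl x"
  then show "y \<in> (\<Union>h\<in>H. {h + x})" by (intro UN_I[of "y - x"]) (simp_all add: cl_def)
qed (auto simp: cl_def)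

lemma r_coset_eq: "H +>\<^bsub>concrete_algebra U mu scale\<^esub> x = cl x"
  by (simp add: a_r_coset_def r_coset_def rcoset_eq)

lemma carrier_Q: "carrier Q = cl ` U"
  by (auto simp: quotient_algebra_def A_RCOSETS_def RCOSETS_def r_coset_def rcoset_eq)

lemma zero_Q: "\<zero>\<^bsub>Q\<^esub> = cl 0"
  by (simp add: quotient_algebra_def cl_def)

lemma mult_Q: "x \<in> U \<Longrightarrow> y \<in> U \<Longrightarrow> cl x \<otimes>\<^bsub>Q\<^esub> cl y = cl (mu x y)"
proof -
  assume xy: "x \<in> U" "y \<in> U"
  have "cl (mu a b) = cl (mu x y)" if "a \<in> cl x" "b \<in> cl y" for a b
    unfolding cl_eq_iff
    using xy cl_subset[OF xy(1) that(1)] cl_subset[OF xy(2) that(2)] that[unfolded cl_def mem_Collect_eq]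
    by (intro mu_cong)
  then have "(\<Union>a\<in>cl x. \<Union>b\<in>cl y. cl (mu a b)) = cl (mu x y)"
    using cl_self by blast
  then show ?thesis
    by (simp add: quotient_algebra_def rcoset_mult_def r_coset_eq)
qed

lemma add_Q: "cl x \<oplus>\<^bsub>Q\<^esub> cl y = cl (x + y)"
proof -
  have "(\<Union>a\<in>cl x. \<Union>b\<in>cl y. {a + b}) = cl (x + y)"
  proof (intro equalityI subsetI)
    fix z assume "z \<in> (\<Union>a\<in>cl x. \<Union>b\<in>cl y. {a + b})"
    then obtain a b where "z = a + b" "a - x \<in> H" "b - y \<in> H" by (auto simp: cl_def)
    then show "z \<in> cl (x + y)"
      using subspace_add[OF subspace_H, of "a - x" "b - y"] by (simp add: cl_def algebra_simps)
  next
    fix z assume "z \<in> cl (x + y)"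
    then have "z - y \<in> cl x" "z = (z - y) + y" by (simp_all add: cl_def algebra_simps)
    then show "z \<in> (\<Union>a\<in>cl x. \<Union>b\<in>cl y. {a + b})" using cl_self[of y] by blast
  qed
  then show ?thesis
    by (simp add: quotient_algebra_def set_add_def set_mult_def)
qed

lemma smult_Q: "c \<odot>\<^bsub>Q\<^esub> cl x = cl (c *s x)"
proof -
  have "cl (c *s a) = cl (c *s x)" if "a \<in> cl x" for a
    unfolding cl_eq_iff
    using that[unfolded cl_def mem_Collect_eq] subspace_scale[OF subspace_H, of "a - x" c]
    by (simp add: scale_right_diff_distrib)
  then have "(\<Union>a\<in>cl x. cl (c *s a)) = cl (c *s x)"
    using cl_self by blast
  then show ?thesis
    by (simp add: quotient_algebra_def r_coset_eq)
qed

lemma inv_Q: "x \<in> U \<Longrightarrow> m_inv (add_monoid Q) (cl x) = cl (- x)"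
proof -
  assume x: "x \<in> U"
  have "(THE y. y \<in> cl ` U \<and> cl x \<oplus>\<^bsub>Q\<^esub> y = cl 0 \<and> y \<oplus>\<^bsub>Q\<^esub> cl x = cl 0) = cl (- x)"
  proof (rule the_equality)
    show "cl (- x) \<in> cl ` U \<and> cl x \<oplus>\<^bsub>Q\<^esub> cl (- x) = cl 0 \<and> cl (- x) \<oplus>\<^bsub>Q\<^esub> cl x = cl 0"
      using x subspace_neg[OF subspace_U] by (simp add: add_Q)
    show "y = cl (- x)" if y: "y \<in> cl ` U \<and> cl x \<oplus>\<^bsub>Q\<^esub> y = cl 0 \<and> y \<oplus>\<^bsub>Q\<^esub> cl x = cl 0" for y
    proof -
      obtain z where z: "y = cl z" using y by blast
      have "x + z - 0 \<in> H" using y by (simp add: z add_Q cl_eq_iff)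
      then show ?thesis by (simp add: z cl_eq_iff add.commute)
    qed
  qed
  then show ?thesis by (simp add: m_inv_def carrier_Q zero_Q)
qed

lemma submodule_image_cl:
  assumes V: "subspace V" "V \<subseteq> U"
  shows "submodule (cl ` V) ring_of_type_algebra Q"
proof -
  have "cl ` V \<subseteq> cl ` U" using V by blast
  moreover have "cl x \<oplus>\<^bsub>Q\<^esub> cl y \<in> cl ` V" if "x \<in> V" "y \<in> V" for x y
    using that V(1) by (simp add: add_Q subspace_add)
  moreover have "m_inv (add_monoid Q) (cl x) \<in> cl ` V" if "x \<in> V" for x
    using that V subspace_neg by (auto simp: inv_Q)
  moreover have "\<zero>\<^bsub>Q\<^esub> \<in> cl ` V" using V(1) by (simp add: zero_Q subspace_0)
  moreover have "c \<odot>\<^bsub>Q\<^esub> cl x \<in> cl ` V" if "x \<in> V" for c x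
    using that V(1) by (simp add: smult_Q subspace_scale)
  ultimately show ?thesis
    by (auto simp: submodule_def submodule_axioms_def subgroup_def carrier_Q)
qed

text \<open>
  The classes of \<open>V\<close> form an ideal of the quotient, and it is square-zero as soon as products in \<open>V\<close>
  fall into \<open>H\<close>. This form lets semisimplicity be used without computing with cosets.
\<close>

lemma semisimple_quotient_no_square_zero_ideal:
  assumes ss: "semisimple_algebra ring_of_type_algebra Q"
    and V: "subspace V" "V \<subseteq> U"
    and ideal: "\<And>a x. a \<in> U \<Longrightarrow> x \<in> V \<Longrightarrow> mu a x \<in> V" "\<And>a x. a \<in> U \<Longrightarrow> x \<in> V \<Longrightarrow> mu x a \<in> V"
    and sq: "\<And>x y. x \<in> V \<Longrightarrow> y \<in> V \<Longrightarrow> mu x y \<in> H"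
  shows "V \<subseteq> H"
proof -
  have "is_two_sided_ideal ring_of_type_algebra Q (cl ` V)"
    using V ideal submodule_image_cl[OF V]
    by (auto simp: is_two_sided_ideal_def is_left_ideal_def carrier_Q mult_Q subset_iff)
  moreover have "nilpotent_set Q (cl ` V)"
    unfolding nilpotent_set_def
  proof (intro exI[of _ 1] allI impI)
    fix x xs assume *: "x \<in> cl ` V \<and> set xs \<subseteq> cl ` V \<and> length xs = 1"
    then obtain y where "xs = [y]" by (auto simp: length_Suc_conv)
    then obtain a b where ab: "x = cl a" "xs = [cl b]" "a \<in> V" "b \<in> V" using * by auto
    have "cl (mu a b) = cl 0" using sq[OF ab(3,4)] by (simp add: cl_eq_iff)
    moreover have "a \<in> U" "b \<in> U" using ab V by auto
    ultimately show "foldl (\<otimes>\<^bsub>Q\<^esub>) x xs = \<zero>\<^bsub>Q\<^esub>" by (simp add: ab mult_Q zero_Q)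
  qed
  ultimately have "cl ` V \<subseteq> {\<zero>\<^bsub>Q\<^esub>}"
    using ss by (auto simp: semisimple_algebra_def is_radical_def)
  then show ?thesis by (auto simp: zero_Q cl_eq_iff)
qed

end

section \<open>Coordinates for the scalar extension of a quotient algebra\<close>

definition pointwise_scale :: "'l::field \<Rightarrow> ('b \<Rightarrow> 'l) \<Rightarrow> 'b \<Rightarrow> 'l" where
  "pointwise_scale c f = (\<lambda>x. c * f x)"

lemma pointwise_scale_apply [simp]: "pointwise_scale c f x = c * f x"
  by (simp add: pointwise_scale_def)

interpretation pointwise: vector_space pointwise_scale
  by unfold_locales (simp_all add: fun_eq_iff algebra_simps)

lemma sum_fun_apply: "(\<Sum>i\<in>A. f i) x = (\<Sum>i\<in>A. f i x)"
  by (induction A rule: infinite_finite_induct) simp_all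

text \<open>
  \<open>D\<close> is a basis of a complement of the ideal \<open>R\<close>, and \<open>coord x\<close> are the coordinates of the class of \<open>x\<close>
  modulo \<open>R\<close> in the basis that \<open>D\<close> induces on the quotient. The structure constants of
  the quotient are \<open>coord (p * q)\<close> with \<open>p, q \<in> D\<close>.
\<close>

locale quotient_coordinates = fin_dim_algebra scale
  for scale :: "'k::field \<Rightarrow> 'a::ring \<Rightarrow> 'a" (infixr \<open>*s\<close> 75) +
  fixes R D :: "'a set" and coord :: "'a \<Rightarrow> 'a \<Rightarrow> 'k"
  assumes subspace_R: "subspace R"
    and R_left: "x \<in> R \<Longrightarrow> a * x \<in> R" and R_right: "x \<in> R \<Longrightarrow> x * a \<in> R"
    and finite_D: "finite D"
    and coord_add: "coord (x + y) d = coord x d + coord y d"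
    and coord_scale: "coord (c *s x) d = c * coord x d"
    and coord_R: "x \<in> R \<Longrightarrow> coord x d = 0"
    and coord_D: "d \<in> D \<Longrightarrow> coord d e = (if d = e then 1 else 0)"
    and coord_outside: "e \<notin> D \<Longrightarrow> coord x e = 0"
    and coord_expand: "x - (\<Sum>d\<in>D. coord x d *s d) \<in> R"
begin

lemma sum_scale_mult_left: "(\<Sum>i\<in>A. c i *s f i) * y = (\<Sum>i\<in>A. c i *s (f i * y))"
  by (simp add: sum_distrib_right scale_mult_left)

lemma sum_scale_mult_right: "y * (\<Sum>i\<in>A. c i *s f i) = (\<Sum>i\<in>A. c i *s (y * f i))"
  by (simp add: sum_distrib_left scale_mult_right)

sublocale base: quotient_by_ideal scale "(*)" UNIV R
proof
  show "x' * y' - x * y \<in> R" if "x' - x \<in> R" "y' - y \<in> R" for x y x' y'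
  proof -
    have "x' * y' - x * y = (x' - x) * y' + x * (y' - y)" by (simp add: algebra_simps)
    then show ?thesis using that R_left R_right subspace_R by (simp add: subspace_add)
  qed
qed (use subspace_R in auto)

text \<open>
  The coordinate vector over the algebraic closure of the element \<open>1 \<otimes> [x]\<close>.
\<close>

definition kap :: "'a \<Rightarrow> 'a \<Rightarrow> 'k alg_closure" where
  "kap x = (\<lambda>d. to_ac (coord x d))"

lemma kap_apply: "kap x d = to_ac (coord x d)"
  by (simp add: kap_def)

lemma kap_add: "kap (x + y) = kap x + kap y"
  by (simp add: kap_def coord_add fun_eq_iff)

lemma kap_scale: "kap (c *s x) = pointwise_scale (to_ac c) (kap x)"
  by (simp add: kap_def coord_scale fun_eq_iff)

lemma kap_R: "x \<in> R \<Longrightarrow> kap x = 0"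
  by (simp add: kap_def coord_R fun_eq_iff)

lemma kap_cong: "x - y \<in> R \<Longrightarrow> kap x = kap y"
  using kap_add[of "x - y" y] kap_R[of "x - y"] by simp

lemma kap_sum: "kap (\<Sum>i\<in>A. c i *s f i) = (\<Sum>i\<in>A. pointwise_scale (to_ac (c i)) (kap (f i)))"
proof (induction A rule: infinite_finite_induct)
  case (insert x F)
  then show ?case by (simp add: kap_add kap_scale)
qed (simp_all add: kap_R subspace_R subspace_0)

lemma kap_D: "d \<in> D \<Longrightarrow> kap d e = (if d = e then 1 else 0)"
  by (simp add: kap_def coord_D)

text \<open>
  The multiplication of the scalar extension in coordinates. It reads only the
  coordinates with index in \<open>D\<close>, which makes it bilinear and associative on all functions.
\<close>

definition ext_mult :: "('a \<Rightarrow> 'k alg_closure) \<Rightarrow> ('a \<Rightarrow> 'k alg_closure) \<Rightarrow> 'a \<Rightarrow> 'k alg_closure"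
    (infixl \<open>\<otimes>\<^sub>K\<close> 70) where
  "v \<otimes>\<^sub>K w = (\<Sum>p\<in>D. \<Sum>q\<in>D. pointwise_scale (v p * w q) (kap (p * q)))"

lemma ext_mult_add_left: "(u + v) \<otimes>\<^sub>K w = u \<otimes>\<^sub>K w + v \<otimes>\<^sub>K w"
  by (simp add: ext_mult_def ring_distribs pointwise.scale_left_distrib sum.distrib)

lemma ext_mult_add_right: "u \<otimes>\<^sub>K (v + w) = u \<otimes>\<^sub>K v + u \<otimes>\<^sub>K w"
  by (simp add: ext_mult_def ring_distribs pointwise.scale_left_distrib sum.distrib)

lemma ext_mult_scale_left: "pointwise_scale c v \<otimes>\<^sub>K w = pointwise_scale c (v \<otimes>\<^sub>K w)"
  by (simp add: ext_mult_def pointwise.scale_sum_right mult.assoc)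

lemma ext_mult_scale_right: "v \<otimes>\<^sub>K pointwise_scale c w = pointwise_scale c (v \<otimes>\<^sub>K w)"
  by (simp add: ext_mult_def pointwise.scale_sum_right mult.left_commute)

lemma ext_mult_sum_left:
  "(\<Sum>i\<in>A. pointwise_scale (c i) (f i)) \<otimes>\<^sub>K w = (\<Sum>i\<in>A. pointwise_scale (c i) (f i \<otimes>\<^sub>K w))"
proof (induction A rule: infinite_finite_induct)
  case (insert x F)
  then show ?case by (simp only: sum.insert[OF insert.hyps] ext_mult_add_left ext_mult_scale_left)
qed (simp_all add: ext_mult_def)

lemma ext_mult_sum_right:
  "w \<otimes>\<^sub>K (\<Sum>i\<in>A. pointwise_scale (c i) (f i)) = (\<Sum>i\<in>A. pointwise_scale (c i) (w \<otimes>\<^sub>K f i))"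
proof (induction A rule: infinite_finite_induct)
  case (insert x F)
  then show ?case by (simp only: sum.insert[OF insert.hyps] ext_mult_add_right ext_mult_scale_right)
qed (simp_all add: ext_mult_def)

lemma kap_ext_mult: "kap x \<otimes>\<^sub>K w = (\<Sum>q\<in>D. pointwise_scale (w q) (kap (x * q)))"
proof -
  have "(\<Sum>p\<in>D. pointwise_scale (kap x p) (kap (p * q))) = kap (x * q)" for q
  proof -
    have "(\<Sum>p\<in>D. pointwise_scale (kap x p) (kap (p * q))) = kap ((\<Sum>p\<in>D. coord x p *s p) * q)"
      by (simp only: sum_scale_mult_left kap_sum kap_apply)
    also have "\<dots> = kap (x * q)"
    proof (rule kap_cong[symmetric])
      show "x * q - (\<Sum>p\<in>D. coord x p *s p) * q \<in> R"
        using R_right[OF coord_expand[of x], of q] by (simp add: left_diff_distrib)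
    qed
    finally show ?thesis .
  qed
  then have "(\<Sum>q\<in>D. pointwise_scale (w q) (kap (x * q))) =
      (\<Sum>q\<in>D. \<Sum>p\<in>D. pointwise_scale (kap x p * w q) (kap (p * q)))"
    by (simp add: pointwise.scale_sum_right[symmetric] mult.commute[of _ "w _"]
        pointwise.scale_scale[symmetric] del: pointwise.scale_scale)
  also have "\<dots> = kap x \<otimes>\<^sub>K w" unfolding ext_mult_def by (rule sum.swap)
  finally show ?thesis ..
qed

lemma ext_mult_kap: "w \<otimes>\<^sub>K kap x = (\<Sum>p\<in>D. pointwise_scale (w p) (kap (p * x)))"
proof -
  have "(\<Sum>q\<in>D. pointwise_scale (kap x q) (kap (p * q))) = kap (p * x)" for p
  proof -
    have "(\<Sum>q\<in>D. pointwise_scale (kap x q) (kap (p * q))) = kap (p * (\<Sum>q\<in>D. coord x q *s q))"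
      by (simp only: sum_scale_mult_right kap_sum kap_apply)
    also have "\<dots> = kap (p * x)"
    proof (rule kap_cong[symmetric])
      show "p * x - p * (\<Sum>q\<in>D. coord x q *s q) \<in> R"
        using R_left[OF coord_expand[of x], of p] by (simp add: right_diff_distrib)
    qed
    finally show ?thesis .
  qed
  then show ?thesis
    by (simp add: ext_mult_def pointwise.scale_sum_right[symmetric]
        pointwise.scale_scale[symmetric] del: pointwise.scale_scale)
qed

lemma kap_mult: "kap x \<otimes>\<^sub>K kap y = kap (x * y)"
proof -
  have "kap x \<otimes>\<^sub>K kap y = kap (x * (\<Sum>q\<in>D. coord y q *s q))"
    unfolding kap_ext_mult by (simp only: sum_scale_mult_right kap_sum kap_apply)
  also have "\<dots> = kap (x * y)"
  proof (rule kap_cong[symmetric])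
    show "x * y - x * (\<Sum>q\<in>D. coord y q *s q) \<in> R"
      using R_left[OF coord_expand[of y], of x] by (simp add: right_diff_distrib)
  qed
  finally show ?thesis .
qed

text \<open>
  After expansion, both sides are combinations of \<open>kap (p * q * r)\<close>, so associativity comes from
  that of the given algebra by way of \<open>kap_ext_mult\<close> and \<open>ext_mult_kap\<close>.
\<close>

lemma ext_mult_assoc: "(u \<otimes>\<^sub>K v) \<otimes>\<^sub>K w = u \<otimes>\<^sub>K (v \<otimes>\<^sub>K w)"
proof -
  have sum2_left: "(\<Sum>i\<in>A. \<Sum>j\<in>B. pointwise_scale (c i j) (f i j)) \<otimes>\<^sub>K z =
      (\<Sum>i\<in>A. \<Sum>j\<in>B. pointwise_scale (c i j) (f i j \<otimes>\<^sub>K z))" for A B c f z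
    using ext_mult_sum_left[of "\<lambda>_. 1" "\<lambda>i. \<Sum>j\<in>B. pointwise_scale (c i j) (f i j)" A z]
    by (simp add: ext_mult_sum_left)
  have sum2_right: "z \<otimes>\<^sub>K (\<Sum>i\<in>A. \<Sum>j\<in>B. pointwise_scale (c i j) (f i j)) =
      (\<Sum>i\<in>A. \<Sum>j\<in>B. pointwise_scale (c i j) (z \<otimes>\<^sub>K f i j))" for A B c f z
    using ext_mult_sum_right[of z "\<lambda>_. 1" "\<lambda>i. \<Sum>j\<in>B. pointwise_scale (c i j) (f i j)" A]
    by (simp add: ext_mult_sum_right)
  have "(u \<otimes>\<^sub>K v) \<otimes>\<^sub>K w =
      (\<Sum>p\<in>D. \<Sum>q\<in>D. \<Sum>r\<in>D. pointwise_scale (u p * v q * w r) (kap (p * q * r)))"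
    unfolding ext_mult_def[of u v] sum2_left kap_ext_mult
    by (simp add: pointwise.scale_sum_right)
  also have "\<dots> = (\<Sum>q\<in>D. \<Sum>r\<in>D. \<Sum>p\<in>D. pointwise_scale (u p * v q * w r) (kap (p * q * r)))"
    by (subst sum.swap) (rule sum.cong[OF refl], rule sum.swap)
  also have "\<dots> = u \<otimes>\<^sub>K (v \<otimes>\<^sub>K w)"
    unfolding ext_mult_def[of v w] sum2_right ext_mult_kap
    by (simp add: pointwise.scale_sum_right mult.assoc mult.left_commute mult.commute)
  finally show ?thesis .
qed

definition W :: "('a \<Rightarrow> 'k alg_closure) set" where
  "W = {v. \<forall>d. d \<notin> D \<longrightarrow> v d = 0}"

lemma kap_in_W: "kap x \<in> W"
  by (simp add: W_def kap_def coord_outside)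

lemma subspace_W: "pointwise.subspace W"
  by (simp add: pointwise.subspace_def W_def)

lemma W_mult: "v \<otimes>\<^sub>K w \<in> W"
  unfolding ext_mult_def
  by (intro pointwise.subspace_sum[OF subspace_W] pointwise.subspace_scale[OF subspace_W] kap_in_W)

lemma W_expand:
  assumes "v \<in> W"
  shows "v = (\<Sum>d\<in>D. pointwise_scale (v d) (kap d))"
proof
  fix e
  have "(\<Sum>d\<in>D. pointwise_scale (v d) (kap d)) e = (\<Sum>d\<in>D. if d = e then v d else 0)"
    unfolding sum_fun_apply by (rule sum.cong) (simp_all add: kap_D)
  then show "v e = (\<Sum>d\<in>D. pointwise_scale (v d) (kap d)) e"
    using assms finite_D by (simp add: W_def)
qed

lemma W_subset_span: "W \<subseteq> pointwise.span (kap ` D)"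
proof
  fix v assume "v \<in> W"
  have "(\<Sum>d\<in>D. pointwise_scale (v d) (kap d)) \<in> pointwise.span (kap ` D)"
    by (intro pointwise.span_sum pointwise.span_scale pointwise.span_base imageI)
  then show "v \<in> pointwise.span (kap ` D)" using W_expand[OF \<open>v \<in> W\<close>] by simp
qed

end

section \<open>The scalar extension as a quotient of the free algebra\<close>

text \<open>
  The element \<open>1\<close> of the algebraic closure, as a vector space over the base field, can be extended
  to a basis.
\<close>

lemma to_ac_retraction:
  shows "\<exists>\<pi> :: 'k::field alg_closure \<Rightarrow> 'k. (\<forall>x y. \<pi> (x + y) = \<pi> x + \<pi> y) \<and>
    (\<forall>c x. \<pi> (to_ac c * x) = c * \<pi> x) \<and> (\<forall>c. \<pi> (to_ac c) = c)"
proof -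
  interpret pair: vector_space_pair "\<lambda>c (x :: 'k alg_closure). to_ac c * x" "(*) :: 'k \<Rightarrow> 'k \<Rightarrow> 'k"
    by unfold_locales (simp_all add: algebra_simps)
  have "\<not> pair.vs1.dependent {1 :: 'k alg_closure}" by simp
  then obtain g where g: "Vector_Spaces.linear (\<lambda>c (x :: 'k alg_closure). to_ac c * x) (*) g"
    "\<forall>x\<in>{1}. g x = (1 :: 'k)"
    using pair.linear_independent_extend[of "{1}" "\<lambda>_. 1"] by blast
  interpret g: Vector_Spaces.linear "\<lambda>c (x :: 'k alg_closure). to_ac c * x" "(*) :: 'k \<Rightarrow> 'k \<Rightarrow> 'k" g
    by (rule g(1))
  have "g (to_ac c) = c" for c using g.scale[of c 1] g(2) by simp
  then show ?thesis using g.add g.scale by blast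
qed

context quotient_coordinates
begin

abbreviation B where "B \<equiv> base.Q"

definition free_carrier :: "('a set \<Rightarrow> 'k alg_closure) set" where
  "free_carrier = {f. finite {C. f C \<noteq> 0} \<and> {C. f C \<noteq> 0} \<subseteq> carrier B}"

definition free_mult ::
    "('a set \<Rightarrow> 'k alg_closure) \<Rightarrow> ('a set \<Rightarrow> 'k alg_closure) \<Rightarrow> 'a set \<Rightarrow> 'k alg_closure" where
  "free_mult f g = (\<lambda>z. finsum ring_of_type_algebra (\<lambda>(x, y). f x * g y)
    {(x, y). f x \<noteq> 0 \<and> g y \<noteq> 0 \<and> x \<otimes>\<^bsub>B\<^esub> y = z})"

lemma free_algebra_eq:
  "free_algebra_on ring_of_type_algebra B = concrete_algebra free_carrier free_mult pointwise_scale"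
  by (simp add: free_algebra_on_def concrete_algebra_def free_carrier_def free_mult_def
      fun_eq_iff zero_fun_def plus_fun_def pointwise_scale_def)

definition kap_class :: "'a set \<Rightarrow> 'a \<Rightarrow> 'k alg_closure" where
  "kap_class C = kap (SOME x. x \<in> C)"

lemma kap_class_cl: "kap_class (base.cl x) = kap x"
proof -
  have "(SOME y. y \<in> base.cl x) \<in> base.cl x" using base.cl_self by (rule someI)
  then show ?thesis unfolding kap_class_def by (intro kap_cong) (simp add: base.cl_def)
qed

lemma kap_class_mult:
  assumes "C \<in> carrier B" "C' \<in> carrier B"
  shows "kap_class C \<otimes>\<^sub>K kap_class C' = kap_class (C \<otimes>\<^bsub>B\<^esub> C')"
  using assms by (auto simp: base.carrier_Q base.mult_Q kap_class_cl kap_mult)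

text \<open>
  The algebra homomorphism from the free algebra to coordinate vectors that sends the generator of the class
  of \<open>x\<close> to \<open>kap x\<close>. The two lemmas \<open>relations_subset_Phi_kernel\<close> and
  \<open>Phi_kernel_subset\<close> below show that its kernel is the subspace spanned by the tensor relations.
\<close>

definition Phi :: "('a set \<Rightarrow> 'k alg_closure) \<Rightarrow> 'a \<Rightarrow> 'k alg_closure" where
  "Phi f = (\<Sum>C\<in>{C. f C \<noteq> 0}. pointwise_scale (f C) (kap_class C))"

lemma Phi_eq:
  assumes "finite S" "{C. f C \<noteq> 0} \<subseteq> S"
  shows "Phi f = (\<Sum>C\<in>S. pointwise_scale (f C) (kap_class C))"
  unfolding Phi_def using assms by (intro sum.mono_neutral_left) auto

lemma free_carrierD:
  assumes "f \<in> free_carrier"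
  shows "finite {C. f C \<noteq> 0}" "{C. f C \<noteq> 0} \<subseteq> carrier B"
  using assms by (auto simp: free_carrier_def)

lemma subspace_free_carrier: "pointwise.subspace free_carrier"
proof -
  have "f + g \<in> free_carrier" if "f \<in> free_carrier" "g \<in> free_carrier" for f g
  proof -
    have "{C. (f + g) C \<noteq> 0} \<subseteq> {C. f C \<noteq> 0} \<union> {C. g C \<noteq> 0}" by auto
    moreover have "finite ({C. f C \<noteq> 0} \<union> {C. g C \<noteq> 0})"
      using that free_carrierD by auto
    ultimately show ?thesis
      using that unfolding free_carrier_def by (blast intro: finite_subset)
  qed
  moreover have "pointwise_scale c f \<in> free_carrier" if "f \<in> free_carrier" for c f
  proof -
    have "{C. pointwise_scale c f C \<noteq> 0} \<subseteq> {C. f C \<noteq> 0}" by auto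
    then show ?thesis
      using that unfolding free_carrier_def by (blast intro: finite_subset)
  qed
  moreover have "0 \<in> free_carrier" by (simp add: free_carrier_def)
  ultimately show ?thesis by (simp add: pointwise.subspace_def)
qed

lemma Phi_add:
  assumes "f \<in> free_carrier" "g \<in> free_carrier"
  shows "Phi (f + g) = Phi f + Phi g"
proof -
  let ?S = "{C. f C \<noteq> 0} \<union> {C. g C \<noteq> 0}"
  have S: "finite ?S" using assms free_carrierD by auto
  have "Phi f = (\<Sum>C\<in>?S. pointwise_scale (f C) (kap_class C))"
    "Phi g = (\<Sum>C\<in>?S. pointwise_scale (g C) (kap_class C))"
    "Phi (f + g) = (\<Sum>C\<in>?S. pointwise_scale ((f + g) C) (kap_class C))"
    by (rule Phi_eq[OF S]; auto)+
  then show ?thesis by (simp add: pointwise.scale_left_distrib sum.distrib)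
qed

lemma Phi_scale:
  assumes "f \<in> free_carrier"
  shows "Phi (pointwise_scale c f) = pointwise_scale c (Phi f)"
proof -
  have "Phi (pointwise_scale c f) = (\<Sum>C\<in>{C. f C \<noteq> 0}. pointwise_scale (pointwise_scale c f C) (kap_class C))"
    using free_carrierD(1)[OF assms] by (rule Phi_eq) auto
  then show ?thesis by (simp add: Phi_def pointwise.scale_sum_right)
qed

lemma Phi_diff:
  assumes "f \<in> free_carrier" "g \<in> free_carrier"
  shows "Phi (f - g) = Phi f - Phi g"
proof -
  have "f - g \<in> free_carrier" using assms pointwise.subspace_diff[OF subspace_free_carrier] by blast
  from Phi_add[OF this assms(2)] show ?thesis by simp
qed

lemma Phi_sum:
  assumes "\<And>i. i \<in> A \<Longrightarrow> f i \<in> free_carrier"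
  shows "Phi (\<Sum>i\<in>A. pointwise_scale (c i) (f i)) = (\<Sum>i\<in>A. pointwise_scale (c i) (Phi (f i)))"
  using assms
proof (induction A rule: infinite_finite_induct)
  case (insert x F)
  have "(\<Sum>i\<in>F. pointwise_scale (c i) (f i)) \<in> free_carrier"
    using insert.prems by (intro pointwise.subspace_sum[OF subspace_free_carrier]
      pointwise.subspace_scale[OF subspace_free_carrier]) simp
  moreover have "pointwise_scale (c x) (f x) \<in> free_carrier"
    using insert.prems by (intro pointwise.subspace_scale[OF subspace_free_carrier]) simp
  moreover have "f x \<in> free_carrier" using insert.prems by simp
  ultimately show ?case
    using insert.IH[OF insert.prems] by (simp only: sum.insert[OF insert.hyps(1,2)] Phi_add Phi_scale insertI2)
qed (simp_all add: Phi_def)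

lemma free_mult_eq:
  assumes "f \<in> free_carrier" "g \<in> free_carrier"
  shows "free_mult f g z = (\<Sum>(x, y)\<in>{p \<in> {x. f x \<noteq> 0} \<times> {y. g y \<noteq> 0}. fst p \<otimes>\<^bsub>B\<^esub> snd p = z}. f x * g y)"
proof -
  have eq: "{(x, y). f x \<noteq> 0 \<and> g y \<noteq> 0 \<and> x \<otimes>\<^bsub>B\<^esub> y = z} =
      {p \<in> {x. f x \<noteq> 0} \<times> {y. g y \<noteq> 0}. fst p \<otimes>\<^bsub>B\<^esub> snd p = z}" by auto
  have "finite {p \<in> {x. f x \<noteq> 0} \<times> {y. g y \<noteq> 0}. fst p \<otimes>\<^bsub>B\<^esub> snd p = z}"
    using assms free_carrierD(1) by simp
  then show ?thesis
    unfolding free_mult_def eq by (rule finsum_ring_of_type_algebra)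
qed

lemma Phi_mult:
  assumes f: "f \<in> free_carrier" and g: "g \<in> free_carrier"
  shows "free_mult f g \<in> free_carrier" "Phi (free_mult f g) = Phi f \<otimes>\<^sub>K Phi g"
proof -
  define S where "S = {x. f x \<noteq> 0} \<times> {y. g y \<noteq> 0}"
  define m where "m p = fst p \<otimes>\<^bsub>B\<^esub> snd p" for p
  have S: "finite S" using f g free_carrierD by (simp add: S_def)
  have mult: "free_mult f g z = (\<Sum>p\<in>{p \<in> S. m p = z}. f (fst p) * g (snd p))" for z
    unfolding free_mult_eq[OF f g] S_def m_def by (simp add: case_prod_unfold)
  have supp: "{z. free_mult f g z \<noteq> 0} \<subseteq> m ` S"
  proof
    fix z assume z: "z \<in> {z. free_mult f g z \<noteq> 0}"
    show "z \<in> m ` S"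
    proof (rule ccontr)
      assume "z \<notin> m ` S"
      then have "{p \<in> S. m p = z} = {}" by blast
      then have "free_mult f g z = 0" unfolding mult by (simp only: sum.empty)
      then show False using z by simp
    qed
  qed
  have S_carrier: "fst p \<in> carrier B" "snd p \<in> carrier B" if "p \<in> S" for p
    using that free_carrierD(2)[OF f] free_carrierD(2)[OF g] by (auto simp: S_def)
  have "m p \<in> carrier B" if p: "p \<in> S" for p
  proof -
    obtain a b where "fst p = base.cl a" "snd p = base.cl b"
      using S_carrier[OF p] unfolding base.carrier_Q by blast
    then show ?thesis by (simp add: m_def base.mult_Q base.carrier_Q)
  qed
  then have "m ` S \<subseteq> carrier B" by blast
  then show "free_mult f g \<in> free_carrier"
    using subset_trans[OF supp] finite_subset[OF supp finite_imageI[OF S]]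
    unfolding free_carrier_def by simp
  have "Phi (free_mult f g) = (\<Sum>z\<in>m ` S. pointwise_scale (free_mult f g z) (kap_class z))"
    using S supp by (intro Phi_eq) auto
  also have "\<dots> = (\<Sum>z\<in>m ` S. \<Sum>p\<in>{p \<in> S. m p = z}. pointwise_scale (f (fst p) * g (snd p)) (kap_class (m p)))"
    by (rule sum.cong) (simp_all add: mult pointwise.scale_sum_left)
  also have "\<dots> = (\<Sum>p\<in>S. pointwise_scale (f (fst p) * g (snd p)) (kap_class (m p)))"
    by (rule sum.image_gen[OF S, symmetric])
  also have "\<dots> = (\<Sum>p\<in>S. pointwise_scale (f (fst p) * g (snd p)) (kap_class (fst p) \<otimes>\<^sub>K kap_class (snd p)))"
  proof (rule sum.cong[OF refl])
    fix p assume "p \<in> S"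
    note S_carrier[OF this]
    then show "pointwise_scale (f (fst p) * g (snd p)) (kap_class (m p)) =
        pointwise_scale (f (fst p) * g (snd p)) (kap_class (fst p) \<otimes>\<^sub>K kap_class (snd p))"
      by (simp only: m_def kap_class_mult)
  qed
  also have "\<dots> = (\<Sum>x\<in>{x. f x \<noteq> 0}. \<Sum>y\<in>{y. g y \<noteq> 0}.
      pointwise_scale (f x * g y) (kap_class x \<otimes>\<^sub>K kap_class y))"
    unfolding S_def by (simp only: sum.cartesian_product case_prod_unfold)
  also have "\<dots> = Phi f \<otimes>\<^sub>K Phi g"
  proof -
    have "Phi f \<otimes>\<^sub>K Phi g = (\<Sum>x\<in>{x. f x \<noteq> 0}. pointwise_scale (f x) (kap_class x \<otimes>\<^sub>K Phi g))"
      unfolding Phi_def[of f] by (rule ext_mult_sum_left)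
    then show ?thesis
      unfolding Phi_def[of g] ext_mult_sum_right pointwise.scale_sum_right pointwise.scale_scale ..
  qed
  finally show "Phi (free_mult f g) = Phi f \<otimes>\<^sub>K Phi g" .
qed

definition gen :: "'a \<Rightarrow> 'a set \<Rightarrow> 'k alg_closure" where
  "gen x = free_gen ring_of_type_algebra (base.cl x)"

lemma gen_apply: "gen x C = (if C = base.cl x then 1 else 0)"
  by (simp add: gen_def free_gen_def)

lemma gen_in_free_carrier: "gen x \<in> free_carrier"
proof -
  have "{C. gen x C \<noteq> 0} = {base.cl x}" by (auto simp: gen_apply)
  then show ?thesis by (simp add: free_carrier_def base.carrier_Q)
qed

lemma Phi_gen: "Phi (gen x) = kap x"
proof -
  have "Phi (gen x) = (\<Sum>C\<in>{base.cl x}. pointwise_scale (gen x C) (kap_class C))"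
    by (rule Phi_eq) (auto simp: gen_apply)
  then show ?thesis by (simp add: gen_apply kap_class_cl)
qed

definition relations :: "('a set \<Rightarrow> 'k alg_closure) set" where
  "relations = tensor_relations ring_of_type_algebra ring_of_type_algebra to_ac B"

lemma relations_eq:
  "relations = {gen (x + y) - (gen x + gen y) | x y. True} \<union>
    {gen (c *s x) - pointwise_scale (to_ac c) (gen x) | c x. True}"
proof -
  let ?M = "concrete_algebra free_carrier free_mult pointwise_scale"
  have minus: "f \<ominus>\<^bsub>?M\<^esub> g = f - g" if "g \<in> free_carrier" for f g
    using pointwise.a_inv_concrete_algebra(1)[OF subspace_free_carrier that, of free_mult]
    by (simp add: a_minus_def)
  have "gen x + gen y \<in> free_carrier" "pointwise_scale c (gen x) \<in> free_carrier" for x y c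
    using gen_in_free_carrier subspace_free_carrier
    by (simp_all add: pointwise.subspace_add pointwise.subspace_scale)
  then have minus': "f \<ominus>\<^bsub>?M\<^esub> (gen x + gen y) = f - (gen x + gen y)"
    "f \<ominus>\<^bsub>?M\<^esub> pointwise_scale c (gen x) = f - pointwise_scale c (gen x)" for f x y c
    using minus by blast+
  have gen_add: "free_gen ring_of_type_algebra (base.cl x \<oplus>\<^bsub>B\<^esub> base.cl y) \<ominus>\<^bsub>?M\<^esub>
      (free_gen ring_of_type_algebra (base.cl x) \<oplus>\<^bsub>?M\<^esub> free_gen ring_of_type_algebra (base.cl y)) =
      gen (x + y) - (gen x + gen y)" for x y
    by (simp only: base.add_Q gen_def[symmetric] minus' concrete_algebra_simps)
  have gen_scale: "free_gen ring_of_type_algebra (c \<odot>\<^bsub>B\<^esub> base.cl x) \<ominus>\<^bsub>?M\<^esub>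
      (to_ac c \<odot>\<^bsub>?M\<^esub> free_gen ring_of_type_algebra (base.cl x)) =
      gen (c *s x) - pointwise_scale (to_ac c) (gen x)" for c x
    by (simp only: base.smult_Q gen_def[symmetric] minus' concrete_algebra_simps)
  have "{free_gen ring_of_type_algebra (x \<oplus>\<^bsub>B\<^esub> y) \<ominus>\<^bsub>?M\<^esub>
          (free_gen ring_of_type_algebra x \<oplus>\<^bsub>?M\<^esub> free_gen ring_of_type_algebra y) | x y.
          x \<in> carrier B \<and> y \<in> carrier B} = {gen (x + y) - (gen x + gen y) | x y. True}"
    unfolding base.carrier_Q gen_add[symmetric] by auto
  moreover have "{free_gen ring_of_type_algebra (c \<odot>\<^bsub>B\<^esub> x) \<ominus>\<^bsub>?M\<^esub>
          (to_ac c \<odot>\<^bsub>?M\<^esub> free_gen ring_of_type_algebra x) | c x.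
          c \<in> carrier ring_of_type_algebra \<and> x \<in> carrier B} =
      {gen (c *s x) - pointwise_scale (to_ac c) (gen x) | c x. True}"
    unfolding base.carrier_Q gen_scale[symmetric] by auto
  ultimately show ?thesis
    unfolding relations_def tensor_relations_def free_algebra_eq Let_def by (simp only:)
qed

definition Phi_kernel :: "('a set \<Rightarrow> 'k alg_closure) set" where
  "Phi_kernel = {f \<in> free_carrier. Phi f = 0}"

lemma subspace_Phi_kernel: "pointwise.subspace Phi_kernel"
proof -
  have "Phi 0 = 0" by (simp add: Phi_def)
  then show ?thesis
    using subspace_free_carrier
    by (simp add: pointwise.subspace_def Phi_kernel_def Phi_add Phi_scale)
qed

lemma relations_subset_Phi_kernel: "relations \<subseteq> Phi_kernel"
proof -
  note fc = gen_in_free_carrier pointwise.subspace_add[OF subspace_free_carrier]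
    pointwise.subspace_diff[OF subspace_free_carrier] pointwise.subspace_scale[OF subspace_free_carrier]
  have "gen (x + y) - (gen x + gen y) \<in> Phi_kernel" for x y
    by (simp add: Phi_kernel_def fc Phi_diff Phi_add Phi_gen kap_add)
  moreover have "gen (c *s x) - pointwise_scale (to_ac c) (gen x) \<in> Phi_kernel" for c x
    by (simp add: Phi_kernel_def fc Phi_diff Phi_scale Phi_gen kap_scale)
  ultimately show ?thesis unfolding relations_eq by blast
qed

text \<open>
  Modulo the relations every generator is the combination of the generators of \<open>D\<close> given by its coordinates. Hence
  every \<open>f\<close> is congruent to \<open>\<Sum> Phi f d \<cdot> gen d\<close>, and this is zero if \<open>f\<close> is in the kernel.
\<close>

lemma Phi_kernel_subset:
  assumes N: "pointwise.subspace N" "relations \<subseteq> N"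
  shows "Phi_kernel \<subseteq> N"
proof
  note N_simps = pointwise.subspace_add[OF N(1)] pointwise.subspace_diff[OF N(1)]
    pointwise.subspace_scale[OF N(1)] pointwise.subspace_sum[OF N(1)]
  have add: "gen (x + y) - (gen x + gen y) \<in> N" for x y using N(2) unfolding relations_eq by blast
  have scale: "gen (c *s x) - pointwise_scale (to_ac c) (gen x) \<in> N" for c x
    using N(2) unfolding relations_eq by blast
  have lin: "gen (\<Sum>d\<in>A. c d *s d) - (\<Sum>d\<in>A. pointwise_scale (to_ac (c d)) (gen d)) \<in> N"
    if "finite A" for A c
    using that
  proof (induction A)
    case empty
    show ?case using scale[of 0 0] by simp
  next
    case (insert x A)
    let ?s = "\<Sum>d\<in>A. c d *s d" and ?t = "\<Sum>d\<in>A. pointwise_scale (to_ac (c d)) (gen d)"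
    have "(gen (c x *s x + ?s) - (gen (c x *s x) + gen ?s)) +
        (gen (c x *s x) - pointwise_scale (to_ac (c x)) (gen x)) + (gen ?s - ?t) \<in> N"
      by (rule N_simps(1)[OF N_simps(1)[OF add scale] insert.IH])
    moreover have "(g - (a + b)) + (a - p) + (b - t) = g - (p + t)"
      for g a b p t :: "'a set \<Rightarrow> 'k alg_closure" by (simp add: algebra_simps)
    ultimately show ?case
      by (simp only: sum.insert[OF insert.hyps])
  qed
  have gen_expand: "gen x - (\<Sum>d\<in>D. pointwise_scale (kap x d) (gen d)) \<in> N" for x
  proof -
    have "base.cl x = base.cl (\<Sum>d\<in>D. coord x d *s d)"
      using coord_expand base.cl_eq_iff by simp
    then have "gen x = gen (\<Sum>d\<in>D. coord x d *s d)" by (simp add: gen_def)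
    then show ?thesis using lin[OF finite_D, of "coord x"] by (simp add: kap_apply)
  qed
  fix f assume "f \<in> Phi_kernel"
  then have f: "f \<in> free_carrier" "Phi f = 0" by (auto simp: Phi_kernel_def)
  let ?S = "{C. f C \<noteq> 0}"
  have S: "finite ?S" "?S \<subseteq> carrier B" using free_carrierD[OF f(1)] by auto
  define rep where "rep C = (SOME x. x \<in> C)" for C :: "'a set"
  have rep: "base.cl (rep C) = C" if C: "C \<in> ?S" for C
  proof -
    obtain x where x: "C = base.cl x" using C S(2) by (auto simp: base.carrier_Q)
    have "rep C \<in> C" unfolding rep_def x using base.cl_self by (rule someI)
    then show ?thesis unfolding x base.cl_eq_iff by (simp add: base.cl_def)
  qed
  have f_eq: "f = (\<Sum>C\<in>?S. pointwise_scale (f C) (gen (rep C)))"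
  proof
    fix C'
    have "(\<Sum>C\<in>?S. pointwise_scale (f C) (gen (rep C))) C' = (\<Sum>C\<in>?S. if C' = C then f C else 0)"
      unfolding sum_fun_apply by (rule sum.cong) (use rep in \<open>auto simp: gen_apply\<close>)
    also have "\<dots> = f C'" using S(1) by simp
    finally show "f C' = (\<Sum>C\<in>?S. pointwise_scale (f C) (gen (rep C))) C'" ..
  qed
  let ?g = "\<Sum>C\<in>?S. pointwise_scale (f C) (\<Sum>d\<in>D. pointwise_scale (kap (rep C) d) (gen d))"
  have "f - ?g = (\<Sum>C\<in>?S. pointwise_scale (f C) (gen (rep C) - (\<Sum>d\<in>D. pointwise_scale (kap (rep C) d) (gen d))))"
    by (subst f_eq) (simp only: pointwise.scale_right_diff_distrib sum_subtractf)
  also have "\<dots> \<in> N" by (rule N_simps(4), rule N_simps(3), rule gen_expand)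
  finally have "f - ?g \<in> N" .
  moreover have "?g = (\<Sum>d\<in>D. pointwise_scale (Phi f d) (gen d))"
  proof -
    have "?g = (\<Sum>d\<in>D. \<Sum>C\<in>?S. pointwise_scale (f C * kap (rep C) d) (gen d))"
      unfolding pointwise.scale_sum_right pointwise.scale_scale by (rule sum.swap)
    moreover have "Phi f d = (\<Sum>C\<in>?S. f C * kap (rep C) d)" for d
      by (simp add: Phi_def sum_fun_apply kap_class_def rep_def)
    ultimately show ?thesis by (simp only: pointwise.scale_sum_left)
  qed
  ultimately show "f \<in> N" using f(2) by simp
qed

lemma scalar_extension_eq:
  "scalar_extension ring_of_type_algebra ring_of_type_algebra to_ac B =
    quotient_algebra (concrete_algebra free_carrier free_mult pointwise_scale) Phi_kernel"
proof -
  have "\<Inter>{N. submodule N ring_of_type_algebra (concrete_algebra free_carrier free_mult pointwise_scale) \<and>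
      relations \<subseteq> N} = Phi_kernel"
  proof (intro equalityI Inter_greatest Inter_lower)
    show "Phi_kernel \<in> {N. submodule N ring_of_type_algebra
        (concrete_algebra free_carrier free_mult pointwise_scale) \<and> relations \<subseteq> N}"
      using subspace_Phi_kernel relations_subset_Phi_kernel
      by (simp add: pointwise.submodule_concrete_algebra_iff[OF subspace_free_carrier])
         (auto simp: Phi_kernel_def)
    show "Phi_kernel \<subseteq> N" if "N \<in> {N. submodule N ring_of_type_algebra
        (concrete_algebra free_carrier free_mult pointwise_scale) \<and> relations \<subseteq> N}" for N
      using that Phi_kernel_subset
      by (simp add: pointwise.submodule_concrete_algebra_iff[OF subspace_free_carrier])
  qed
  then show ?thesis by (simp only: scalar_extension_def free_algebra_eq relations_def[symmetric])
qed

sublocale ext: quotient_by_ideal pointwise_scale free_mult free_carrier Phi_kernel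
proof
  show "free_mult x' y' - free_mult x y \<in> Phi_kernel"
    if xy: "x \<in> free_carrier" "y \<in> free_carrier" "x' \<in> free_carrier" "y' \<in> free_carrier"
      and "x' - x \<in> Phi_kernel" "y' - y \<in> Phi_kernel" for x y x' y'
  proof -
    have "Phi x' = Phi x" "Phi y' = Phi y"
      using that by (simp_all add: Phi_kernel_def Phi_diff)
    then show ?thesis
      using xy Phi_mult pointwise.subspace_diff[OF subspace_free_carrier]
      by (simp add: Phi_kernel_def Phi_diff)
  qed
qed (use subspace_free_carrier subspace_Phi_kernel Phi_mult(1) in \<open>auto simp: Phi_kernel_def\<close>)

text \<open>
  Over the algebraic closure, separability says that the free algebra modulo the kernel of \<open>Phi\<close> is
  semisimple. A square-zero ideal of coordinate vectors pulls back along \<open>Phi\<close> to an ideal of the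
  free algebra with products in the kernel, and so it lies in the kernel itself.
\<close>

lemma W_no_square_zero_ideal:
  assumes sep: "separable_algebra B"
    and J: "pointwise.subspace J" "J \<subseteq> W"
    and ideal: "\<And>w x. w \<in> W \<Longrightarrow> x \<in> J \<Longrightarrow> w \<otimes>\<^sub>K x \<in> J" "\<And>w x. w \<in> W \<Longrightarrow> x \<in> J \<Longrightarrow> x \<otimes>\<^sub>K w \<in> J"
    and sq: "\<And>x y. x \<in> J \<Longrightarrow> y \<in> J \<Longrightarrow> x \<otimes>\<^sub>K y = 0"
  shows "J \<subseteq> {0}"
proof
  have ss: "semisimple_algebra ring_of_type_algebra ext.Q"
  proof -
    have "field (ring_of_type_algebra :: 'k alg_closure ring)" by (rule field_from_type_algebra)
    moreover have "to_ac \<in> ring_hom (ring_of_type_algebra :: 'k ring) ring_of_type_algebra"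
      by (simp add: ring_hom_def)
    ultimately show ?thesis
      using sep unfolding separable_algebra_def scalar_extension_eq[symmetric] by blast
  qed
  have Phi_W: "Phi f \<in> W" if "f \<in> free_carrier" for f
    unfolding Phi_def kap_class_def
    by (intro pointwise.subspace_sum[OF subspace_W] pointwise.subspace_scale[OF subspace_W] kap_in_W)
  let ?V = "{f \<in> free_carrier. Phi f \<in> J}"
  have "?V \<subseteq> Phi_kernel"
  proof (rule ext.semisimple_quotient_no_square_zero_ideal[OF ss])
    have "Phi 0 = 0" by (simp add: Phi_def)
    then show "pointwise.subspace ?V"
      using J(1) subspace_free_carrier by (simp add: pointwise.subspace_def Phi_add Phi_scale)
  qed (use ideal sq Phi_W Phi_mult in \<open>auto simp: Phi_kernel_def\<close>)
  fix j assume j: "j \<in> J"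
  let ?f = "\<Sum>d\<in>D. pointwise_scale (j d) (gen d)"
  have "?f \<in> free_carrier"
    by (intro pointwise.subspace_sum[OF subspace_free_carrier]
        pointwise.subspace_scale[OF subspace_free_carrier] gen_in_free_carrier)
  moreover have "Phi ?f = j"
    using W_expand[of j] j J(2) by (simp only: Phi_sum[OF gen_in_free_carrier] Phi_gen) auto
  ultimately show "j \<in> {0}"
    using \<open>?V \<subseteq> Phi_kernel\<close> j by (auto simp: Phi_kernel_def)
qed

end

section \<open>Descent of the separability tensor to the base field\<close>

context quotient_coordinates
begin

text \<open>
  The coefficient matrix \<open>E\<close> of the invariant tensor over the algebraic closure satisfies linear
  equations whose coefficients are structure constants, hence in the base field; a linear
  retraction \<open>\<pi>\<close> onto the base field therefore maps it to a solution there.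
\<close>

lemma separability_coefficients:
  assumes sep: "separable_algebra B"
  shows "\<exists>\<epsilon> :: 'a \<Rightarrow> 'a \<Rightarrow> 'k.
    (\<forall>x p q. (\<Sum>r\<in>D. coord (x * r) p * \<epsilon> r q) = (\<Sum>r\<in>D. \<epsilon> p r * coord (r * x) q)) \<and>
    (\<forall>x e. (\<Sum>p\<in>D. \<Sum>q\<in>D. \<epsilon> p q * coord (p * q * x) e) = coord x e)"
proof -
  interpret split: split_semiprime_algebra pointwise_scale "(\<otimes>\<^sub>K)" W "kap ` D"
  proof
    show "J \<subseteq> {0}"
      if "pointwise.subspace J" "J \<subseteq> W" "\<And>w x. w \<in> W \<Longrightarrow> x \<in> J \<Longrightarrow> w \<otimes>\<^sub>K x \<in> J"
        "\<And>w x. w \<in> W \<Longrightarrow> x \<in> J \<Longrightarrow> x \<otimes>\<^sub>K w \<in> J" "\<And>x y. x \<in> J \<Longrightarrow> y \<in> J \<Longrightarrow> x \<otimes>\<^sub>K y = 0" for J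
      using sep that by (rule W_no_square_zero_ideal)
  qed (rule ext_mult_assoc ext_mult_add_left ext_mult_add_right ext_mult_scale_left
      ext_mult_scale_right subspace_W W_mult W_subset_span finite_imageI[OF finite_D])+
  obtain ts where inv: "split.invariant_tensor ts"
    and unit: "\<And>a. a \<in> W \<Longrightarrow> split.contraction ts \<otimes>\<^sub>K a = a"
    using split.separability_tensor_exists by blast
  define E where "E p q = (\<Sum>(v, w)\<leftarrow>ts. v p * w q)" for p q
  have sum_swap: "(\<Sum>(v, w)\<leftarrow>us. \<Sum>r\<in>A. g r v w) = (\<Sum>r\<in>A. \<Sum>(v, w)\<leftarrow>us. g r v w)"
    for us :: "(('a \<Rightarrow> 'k alg_closure) \<times> ('a \<Rightarrow> 'k alg_closure)) list" and A :: "'a set"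
      and g :: "'a \<Rightarrow> _ \<Rightarrow> _ \<Rightarrow> 'c::comm_monoid_add"
    by (induction us) (auto simp: sum.distrib)
  have E_inv: "(\<Sum>r\<in>D. to_ac (coord (x * r) p) * E r q) = (\<Sum>r\<in>D. E p r * to_ac (coord (r * x) q))" for x p q
  proof -
    have "split.bilinear_form (\<lambda>v w. v p * w q)"
      by (simp add: split.bilinear_form_def algebra_simps)
    from split.invariant_tensorD(2)[OF inv kap_in_W this]
    have eq: "(\<Sum>(v, w)\<leftarrow>ts. (kap x \<otimes>\<^sub>K v) p * w q) = (\<Sum>(v, w)\<leftarrow>ts. v p * (w \<otimes>\<^sub>K kap x) q)" .
    have l: "(kap x \<otimes>\<^sub>K v) p * w q = (\<Sum>r\<in>D. to_ac (coord (x * r) p) * (v r * w q))" for v w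
      unfolding kap_ext_mult sum_fun_apply pointwise_scale_apply kap_apply sum_distrib_right
      by (rule sum.cong) (simp_all add: mult_ac)
    have r: "v p * (w \<otimes>\<^sub>K kap x) q = (\<Sum>r\<in>D. (v p * w r) * to_ac (coord (r * x) q))" for v w
      unfolding ext_mult_kap sum_fun_apply pointwise_scale_apply kap_apply sum_distrib_left
      by (rule sum.cong) (simp_all add: mult_ac)
    show ?thesis
      using eq unfolding l r sum_swap E_def
      by (simp add: sum_list_const_mult sum_list_mult_const case_prod_unfold)
  qed
  have E_unit: "(\<Sum>p\<in>D. \<Sum>q\<in>D. E p q * to_ac (coord (p * q * x) e)) = to_ac (coord x e)" for x e
  proof -
    have scale_sum_list: "(\<Sum>(v, w)\<leftarrow>us. pointwise_scale (v p * w q) z) =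
        pointwise_scale (\<Sum>(v, w)\<leftarrow>us. v p * w q) z"
      for us :: "(('a \<Rightarrow> 'k alg_closure) \<times> ('a \<Rightarrow> 'k alg_closure)) list" and p q
        and z :: "'a \<Rightarrow> 'k alg_closure"
      by (induction us) (auto simp: pointwise.scale_left_distrib)
    have "split.contraction ts = (\<Sum>p\<in>D. \<Sum>q\<in>D. pointwise_scale (E p q) (kap (p * q)))"
      unfolding split.contraction_def ext_mult_def sum_swap scale_sum_list E_def ..
    then have "split.contraction ts \<otimes>\<^sub>K kap x = (\<Sum>p\<in>D. (\<Sum>q\<in>D. pointwise_scale (E p q) (kap (p * q))) \<otimes>\<^sub>K kap x)"
      by (simp only: split.mult_sum_left)
    also have "\<dots> = (\<Sum>p\<in>D. \<Sum>q\<in>D. pointwise_scale (E p q) (kap (p * q * x)))"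
      by (simp only: ext_mult_sum_left kap_mult)
    finally have "kap x = (\<Sum>p\<in>D. \<Sum>q\<in>D. pointwise_scale (E p q) (kap (p * q * x)))"
      using unit[OF kap_in_W] by simp
    then have "kap x e = (\<Sum>p\<in>D. \<Sum>q\<in>D. pointwise_scale (E p q) (kap (p * q * x))) e"
      by (rule arg_cong)
    then show ?thesis by (simp add: sum_fun_apply kap_apply)
  qed
  obtain \<pi> :: "'k alg_closure \<Rightarrow> 'k" where \<pi>': "\<forall>x y. \<pi> (x + y) = \<pi> x + \<pi> y"
    "\<forall>c x. \<pi> (to_ac c * x) = c * \<pi> x" "\<forall>c. \<pi> (to_ac c) = c"
    using to_ac_retraction by blast
  note \<pi> = \<pi>'[rule_format]
  have "\<pi> 0 = 0" using \<pi>(3)[of 0] by simp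
  then have \<pi>_sum: "\<pi> (sum f A) = (\<Sum>i\<in>A. \<pi> (f i))" for f :: "'a \<Rightarrow> 'k alg_closure" and A
    by (induction A rule: infinite_finite_induct) (simp_all add: \<pi>(1))
  have \<pi>_right: "\<pi> (x * to_ac c) = \<pi> x * c" for x c
    using \<pi>(2)[of c x] by (simp add: mult.commute)
  show ?thesis
  proof (intro exI[of _ "\<lambda>p q. \<pi> (E p q)"] conjI allI)
    show "(\<Sum>r\<in>D. coord (x * r) p * \<pi> (E r q)) = (\<Sum>r\<in>D. \<pi> (E p r) * coord (r * x) q)" for x p q
      using arg_cong[OF E_inv[of x p q], of \<pi>] by (simp add: \<pi>_sum \<pi>(2) \<pi>_right)
    show "(\<Sum>p\<in>D. \<Sum>q\<in>D. \<pi> (E p q) * coord (p * q * x) e) = coord x e" for x e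
      using arg_cong[OF E_unit[of x e], of \<pi>] by (simp add: \<pi>_sum \<pi>(3) \<pi>_right)
  qed
qed

text \<open>
  The maps induced by bilinear maps on the quotient modulo \<open>R\<close>; the invariance of a tensor over the
  quotient is tested on them.
\<close>

definition bilinear_mod_R :: "('a \<Rightarrow> 'a \<Rightarrow> 'a) \<Rightarrow> bool" where
  "bilinear_mod_R \<beta> \<longleftrightarrow>
    (\<forall>u v w. \<beta> (u + v) w = \<beta> u w + \<beta> v w) \<and> (\<forall>u v w. \<beta> u (v + w) = \<beta> u v + \<beta> u w) \<and>
    (\<forall>c u v. \<beta> (c *s u) v = c *s \<beta> u v) \<and> (\<forall>c u v. \<beta> u (c *s v) = c *s \<beta> u v) \<and>
    (\<forall>u\<in>R. \<forall>v. \<beta> u v = 0) \<and> (\<forall>u. \<forall>v\<in>R. \<beta> u v = 0)"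

text \<open>
  A bilinear map on the quotient is determined by its values on \<open>D\<close>, so the two sums are obtained from each other
  by expanding \<open>x * p\<close> and \<open>q * x\<close> in coordinates.
\<close>

lemma separability_bilinear:
  assumes sep: "separable_algebra B"
  shows "\<exists>\<epsilon> :: 'a \<Rightarrow> 'a \<Rightarrow> 'k.
    (\<forall>\<beta> x. bilinear_mod_R \<beta> \<longrightarrow>
      (\<Sum>p\<in>D. \<Sum>q\<in>D. \<epsilon> p q *s \<beta> (x * p) q) = (\<Sum>p\<in>D. \<Sum>q\<in>D. \<epsilon> p q *s \<beta> p (q * x))) \<and>
    (\<forall>x. (\<Sum>p\<in>D. \<Sum>q\<in>D. \<epsilon> p q *s (p * q)) * x - x \<in> R)"
proof -
  obtain \<epsilon> :: "'a \<Rightarrow> 'a \<Rightarrow> 'k" where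
    inv: "\<forall>x p q. (\<Sum>r\<in>D. coord (x * r) p * \<epsilon> r q) = (\<Sum>r\<in>D. \<epsilon> p r * coord (r * x) q)" and
    unit: "\<forall>x e. (\<Sum>p\<in>D. \<Sum>q\<in>D. \<epsilon> p q * coord (p * q * x) e) = coord x e"
    using separability_coefficients[OF sep] by blast
  show ?thesis
  proof (intro exI[of _ \<epsilon>] conjI allI impI)
    fix \<beta> x
    assume "bilinear_mod_R \<beta>"
    then have \<beta>: "\<And>u v w. \<beta> (u + v) w = \<beta> u w + \<beta> v w" "\<And>u v w. \<beta> u (v + w) = \<beta> u v + \<beta> u w"
        "\<And>c u v. \<beta> (c *s u) v = c *s \<beta> u v" "\<And>c u v. \<beta> u (c *s v) = c *s \<beta> u v"
        "\<And>u v. u \<in> R \<Longrightarrow> \<beta> u v = 0" "\<And>u v. v \<in> R \<Longrightarrow> \<beta> u v = 0"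
      by (simp_all add: bilinear_mod_R_def)
    have R0: "0 \<in> R" using subspace_R subspace_0 by blast
    have sum_l: "\<beta> (\<Sum>d\<in>A. c d *s d) v = (\<Sum>d\<in>A. c d *s \<beta> d v)" for A c v
      by (induction A rule: infinite_finite_induct) (simp_all add: \<beta> R0)
    have sum_r: "\<beta> v (\<Sum>d\<in>A. c d *s d) = (\<Sum>d\<in>A. c d *s \<beta> v d)" for A c v
      by (induction A rule: infinite_finite_induct) (simp_all add: \<beta> R0)
    have l: "\<beta> u v = (\<Sum>d\<in>D. coord u d *s \<beta> d v)" for u v
      using \<beta>(1)[of "u - (\<Sum>d\<in>D. coord u d *s d)" "\<Sum>d\<in>D. coord u d *s d" v]
        \<beta>(5)[OF coord_expand] by (simp add: sum_l)
    have r: "\<beta> u v = (\<Sum>d\<in>D. coord v d *s \<beta> u d)" for u v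
      using \<beta>(2)[of u "v - (\<Sum>d\<in>D. coord v d *s d)" "\<Sum>d\<in>D. coord v d *s d"]
        \<beta>(6)[OF coord_expand] by (simp add: sum_r)
    have "(\<Sum>p\<in>D. \<Sum>q\<in>D. \<epsilon> p q *s \<beta> (x * p) q) =
        (\<Sum>p\<in>D. \<Sum>q\<in>D. \<Sum>d\<in>D. (coord (x * p) d * \<epsilon> p q) *s \<beta> d q)"
      by (subst l) (simp add: scale_sum_right mult.commute)
    also have "\<dots> = (\<Sum>q\<in>D. \<Sum>p\<in>D. \<Sum>d\<in>D. (coord (x * p) d * \<epsilon> p q) *s \<beta> d q)"
      by (rule sum.swap)
    also have "\<dots> = (\<Sum>q\<in>D. \<Sum>d\<in>D. \<Sum>p\<in>D. (coord (x * p) d * \<epsilon> p q) *s \<beta> d q)"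
      by (rule sum.cong[OF refl], rule sum.swap)
    also have "\<dots> = (\<Sum>q\<in>D. \<Sum>d\<in>D. \<Sum>p\<in>D. (\<epsilon> d p * coord (p * x) q) *s \<beta> d q)"
      by (simp only: scale_sum_left[symmetric] inv[rule_format])
    also have "\<dots> = (\<Sum>d\<in>D. \<Sum>q\<in>D. \<Sum>p\<in>D. (\<epsilon> d p * coord (p * x) q) *s \<beta> d q)"
      by (rule sum.swap)
    also have "\<dots> = (\<Sum>d\<in>D. \<Sum>p\<in>D. \<Sum>q\<in>D. (\<epsilon> d p * coord (p * x) q) *s \<beta> d q)"
      by (rule sum.cong[OF refl], rule sum.swap)
    also have "\<dots> = (\<Sum>d\<in>D. \<Sum>p\<in>D. \<epsilon> d p *s \<beta> d (p * x))"
      by (subst (2) r) (simp add: scale_sum_right)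
    finally show "(\<Sum>p\<in>D. \<Sum>q\<in>D. \<epsilon> p q *s \<beta> (x * p) q) = (\<Sum>p\<in>D. \<Sum>q\<in>D. \<epsilon> p q *s \<beta> p (q * x))" .
  next
    fix x
    let ?u = "\<Sum>p\<in>D. \<Sum>q\<in>D. \<epsilon> p q *s (p * q)"
    have coord_sum: "coord (sum f A) e = (\<Sum>i\<in>A. coord (f i) e)" for f :: "'a \<Rightarrow> 'a" and A e
      using coord_R[of 0] subspace_R
      by (induction A rule: infinite_finite_induct) (simp_all add: coord_add subspace_0)
    have "coord (?u * x) e = coord x e" for e
      using unit[rule_format, of x e] by (simp add: sum_distrib_right scale_mult_left coord_sum coord_scale)
    then have "coord (?u * x - x) e = 0" for e
      using coord_add[of "?u * x - x" x e] by simp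
    then show "?u * x - x \<in> R"
      using coord_expand[of "?u * x - x"] by simp
  qed
qed

end

section \<open>Linear sections adapted to a subspace\<close>

lemma algebra_of_type_eq: "algebra_of_type scale = concrete_algebra UNIV (*) scale"
  by (simp add: algebra_of_type_def concrete_algebra_def)

lemma foldl_mult_left: "a * foldl (*) x xs = foldl (*) (a * x :: 'a::semigroup_mult) xs"
  by (induction xs arbitrary: x) (simp_all add: mult.assoc)

context fin_dim_algebra
begin

lemma finite_independent: "independent S \<Longrightarrow> finite S"
proof -
  obtain Basis where "finite_dimensional_vector_space scale Basis"
    using finite_dimensional by blast
  then interpret fd: finite_dimensional_vector_space scale Basis .
  show "independent S \<Longrightarrow> finite S" by (rule fd.finiteI_independent)
qed

text \<open>
  Choose a linear map \<open>q\<close> with kernel \<open>R\<close> and compose it with a linear right inverse on its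
  range. The right inverse is defined on a basis that extends a basis of \<open>q ` I\<close>, and there it can be
  chosen with values in \<open>I\<close>.
\<close>

lemma linear_section_exists:
  assumes R: "subspace R" and I: "subspace I"
  shows "\<exists>s. Vector_Spaces.linear scale scale s \<and> (\<forall>x. s x - x \<in> R) \<and>
    (\<forall>x\<in>R. s x = 0) \<and> (\<forall>x\<in>I. s x \<in> I)"
proof -
  interpret pair: vector_space_pair scale scale ..
  obtain C where C: "C \<subseteq> R" "independent C" "R \<subseteq> span C"
    by (rule basis_exists[of R]) (rule that)
  have span_C: "span C = R" using span_minimal[OF C(1) R] C(3) by (rule equalityI)
  obtain p where p: "Vector_Spaces.linear scale scale p" "\<forall>x\<in>C. p x = id x" "range p = span (id ` C)"
    using pair.linear_independent_extend_subspace[OF C(2), of id] by blast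
  interpret p: Vector_Spaces.linear scale scale p by (rule p(1))
  have p_R: "p x = x" if "x \<in> R" for x
  proof -
    have "x \<in> span C" using that span_C by simp
    then show ?thesis
      by (induction rule: span_induct_alt) (simp_all add: p.add p.scale p.zero p(2))
  qed
  define q where "q x = x - p x" for x
  have q_add: "q (x + y) = q x + q y" and q_scale: "q (c *s x) = c *s q x" for x y c
    by (simp_all add: q_def p.add p.scale scale_right_diff_distrib)
  have p_in_R: "p x \<in> R" for x
    using rangeI[of p x] unfolding p(3) image_id id_apply span_C .
  have q0: "q x = 0 \<longleftrightarrow> x \<in> R" for x
  proof
    assume "q x = 0"
    then have "x = p x" by (simp add: q_def)
    then show "x \<in> R" using p_in_R[of x] by (rule ssubst)
  next
    assume "x \<in> R"
    then show "q x = 0" using p_R[of x] by (simp add: q_def)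
  qed
  have q_linear: "Vector_Spaces.linear scale scale q"
    by unfold_locales (simp_all add: q_add q_scale)
  interpret q: Vector_Spaces.linear scale scale q by (rule q_linear)
  obtain B1 where B1: "B1 \<subseteq> q ` I" "independent B1" "q ` I \<subseteq> span B1"
    by (rule basis_exists[of "q ` I"]) (rule that)
  obtain B2 where B2: "B1 \<subseteq> B2" "B2 \<subseteq> range q" "independent B2" "range q \<subseteq> span B2"
  proof (rule maximal_independent_subset_extend[of B1 "range q"])
    show "B1 \<subseteq> range q" using B1(1) by blast
  qed (use B1(2) in blast)+
  define f where "f b = (if b \<in> B1 then (SOME y. y \<in> I \<and> q y = b) else (SOME y. q y = b))" for b
  have f1: "f b \<in> I" if "b \<in> B1" for b
    using someI_ex[of "\<lambda>y. y \<in> I \<and> q y = b"] that B1(1) by (auto simp: f_def)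
  have f2: "q (f b) = b" if "b \<in> B2" for b
  proof (cases "b \<in> B1")
    case True
    then show ?thesis using someI_ex[of "\<lambda>y. y \<in> I \<and> q y = b"] B1(1) by (auto simp: f_def)
  next
    case False
    then show ?thesis using someI_ex[of "\<lambda>y. q y = b"] B2(2) that by (auto simp: f_def)
  qed
  obtain g where g: "Vector_Spaces.linear scale scale g" "\<forall>x\<in>B2. g x = f x"
    using pair.linear_independent_extend[OF B2(3)] by blast
  interpret g: Vector_Spaces.linear scale scale g by (rule g(1))
  have qg: "q (g y) = y" if "y \<in> span B2" for y
    using that by (induction rule: span_induct_alt) (simp_all add: g.add g.scale g.zero q.add q.scale q.zero g(2) f2)
  have gI: "g y \<in> I" if "y \<in> span B1" for y
    using that
  proof (induction rule: span_induct_alt)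
    case base
    then show ?case using I by (simp add: g.zero subspace_0)
  next
    case (step c x y)
    then have "g x \<in> I" using g(2) f1 B2(1) by auto
    then show ?case using step I by (simp add: g.add g.scale subspace_add subspace_scale)
  qed
  show ?thesis
  proof (intro exI[of _ "\<lambda>x. g (q x)"] conjI allI ballI)
    show "Vector_Spaces.linear scale scale (\<lambda>x. g (q x))"
      by unfold_locales (simp_all add: q_add q_scale g.add g.scale)
    show "g (q x) - x \<in> R" for x
    proof -
      have "q (g (q x)) = q x" using qg B2(4) by blast
      then have "q (g (q x) - x) = 0" by (simp add: q.diff)
      then show ?thesis by (simp add: q0)
    qed
    show "g (q x) = 0" if "x \<in> R" for x
      using that q0[of x] by (simp add: g.zero)
    show "g (q x) \<in> I" if "x \<in> I" for x using that gI B1(3) by blast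
  qed
qed

lemma quotient_coordinates_exist:
  assumes R: "subspace R" "\<And>a x. x \<in> R \<Longrightarrow> a * x \<in> R" "\<And>a x. x \<in> R \<Longrightarrow> x * a \<in> R"
  obtains D coord where "quotient_coordinates scale R D coord"
proof -
  obtain s where s': "Vector_Spaces.linear scale scale s" "\<forall>x. s x - x \<in> R" "\<forall>x\<in>R. s x = 0"
    using linear_section_exists[OF R(1) subspace_UNIV] by (elim exE conjE)
  note s = s'(1) s'(2)[rule_format] s'(3)[rule_format]
  interpret s: Vector_Spaces.linear scale scale s by (rule s(1))
  have idem: "s (s x) = s x" for x using s(3)[OF s(2)[of x]] by (simp add: s.diff)
  obtain D where D: "D \<subseteq> range s" "independent D" "range s \<subseteq> span D"
    by (rule basis_exists[of "range s"]) (rule that)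
  have fin: "finite D" using D(2) by (rule finite_independent)
  have s_span: "s x \<in> span D" for x using D(3) rangeI by (rule subsetD)
  have "quotient_coordinates scale R D (\<lambda>x. representation D (s x))"
  proof
    show "representation D (s (x + y)) d = representation D (s x) d + representation D (s y) d" for x y d
      using D(2) s_span by (simp add: s.add representation_add)
    show "representation D (s (c *s x)) d = c * representation D (s x) d" for c x d
      using D(2) s_span by (simp add: s.scale representation_scale)
    show "representation D (s x) d = 0" if "x \<in> R" for x d
      using that s(3) by (simp add: representation_zero)
    show "representation D (s d) e = (if d = e then 1 else 0)" if "d \<in> D" for d e
    proof -
      have "s d = d" using that D(1) idem by auto
      then show ?thesis using representation_basis[OF D(2) that] by auto
    qed
    show "representation D (s x) e = 0" if "e \<notin> D" for x e
      using that representation_ne_zero[of D "s x" e] by (cases "representation D (s x) e = 0") simp_all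
    show "x - (\<Sum>d\<in>D. representation D (s x) d *s d) \<in> R" for x
      using sum_representation_eq[OF D(2) s_span fin order_refl] subspace_neg[OF R(1) s(2)[of x]] by simp
  qed (use R fin in auto)
  then show ?thesis by (rule that)
qed

end

section \<open>Lifting sections along powers of a nilpotent ideal\<close>

locale nilpotent_ideal = fin_dim_algebra scale
  for scale :: "'k::field \<Rightarrow> 'a::ring \<Rightarrow> 'a" (infixr \<open>*s\<close> 75) +
  fixes R :: "'a set"
  assumes subspace_R: "subspace R"
    and R_left: "x \<in> R \<Longrightarrow> a * x \<in> R" and R_right: "x \<in> R \<Longrightarrow> x * a \<in> R"
    and R_nilpotent: "nilpotent_set (concrete_algebra UNIV (*) scale) R"
begin

text \<open>
  This is the power of \<open>R\<close> with exponent \<open>m + 1\<close>, so that \<open>Rpow 0 = R\<close>.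
\<close>

definition Rpow :: "nat \<Rightarrow> 'a set" where
  "Rpow m = span {foldl (*) x xs | x xs. x \<in> R \<and> set xs \<subseteq> R \<and> length xs = m}"

lemma Rpow_product: "x \<in> R \<Longrightarrow> set xs \<subseteq> R \<Longrightarrow> foldl (*) x xs \<in> Rpow (length xs)"
  unfolding Rpow_def by (rule span_base) blast

lemma subspace_Rpow: "subspace (Rpow m)"
  unfolding Rpow_def by (rule subspace_span)

lemma Rpow_subsetI:
  assumes "subspace N" "\<And>x xs. x \<in> R \<Longrightarrow> set xs \<subseteq> R \<Longrightarrow> length xs = m \<Longrightarrow> foldl (*) x xs \<in> N"
  shows "Rpow m \<subseteq> N"
  unfolding Rpow_def using assms by (intro span_minimal) auto

lemma Rpow_0: "Rpow 0 = R"
  using subspace_R by (auto simp: Rpow_def intro: span_base)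

lemma Rpow_left: "x \<in> Rpow m \<Longrightarrow> a * x \<in> Rpow m"
proof -
  have "Rpow m \<subseteq> {x. a * x \<in> Rpow m}"
  proof (rule Rpow_subsetI)
    show "subspace {x. a * x \<in> Rpow m}"
      using subspace_Rpow[of m] by (simp add: subspace_def distrib_left scale_mult_right)
    show "foldl (*) x xs \<in> {x. a * x \<in> Rpow m}" if "x \<in> R" "set xs \<subseteq> R" "length xs = m" for x xs
      using Rpow_product[OF R_left[OF that(1)] that(2)] that(3) by (simp add: foldl_mult_left)
  qed
  then show "x \<in> Rpow m \<Longrightarrow> a * x \<in> Rpow m" by blast
qed

lemma Rpow_mult_R: "x \<in> Rpow m \<Longrightarrow> r \<in> R \<Longrightarrow> x * r \<in> Rpow (Suc m)"
proof -
  assume r: "r \<in> R"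
  have "Rpow m \<subseteq> {x. x * r \<in> Rpow (Suc m)}"
  proof (rule Rpow_subsetI)
    show "subspace {x. x * r \<in> Rpow (Suc m)}"
      using subspace_Rpow[of "Suc m"] by (simp add: subspace_def distrib_right scale_mult_left)
    show "foldl (*) x xs \<in> {x. x * r \<in> Rpow (Suc m)}" if "x \<in> R" "set xs \<subseteq> R" "length xs = m" for x xs
      using Rpow_product[of x "xs @ [r]"] that r by simp
  qed
  then show "x \<in> Rpow m \<Longrightarrow> x * r \<in> Rpow (Suc m)" by blast
qed

lemma Rpow_right: "x \<in> Rpow m \<Longrightarrow> x * a \<in> Rpow m"
proof (cases m)
  case 0
  then show "x \<in> Rpow m \<Longrightarrow> x * a \<in> Rpow m" by (simp add: Rpow_0 R_right)
next
  case (Suc k)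
  have "Rpow m \<subseteq> {x. x * a \<in> Rpow m}"
  proof (rule Rpow_subsetI)
    show "subspace {x. x * a \<in> Rpow m}"
      using subspace_Rpow[of m] by (simp add: subspace_def distrib_right scale_mult_left)
    show "foldl (*) x xs \<in> {x. x * a \<in> Rpow m}" if fac: "x \<in> R" "set xs \<subseteq> R" "length xs = m" for x xs
    proof -
      obtain ys y where xs: "xs = ys @ [y]" using fac(3) Suc by (cases xs rule: rev_cases) auto
      then show ?thesis
        using Rpow_product[of x "ys @ [y * a]"] fac R_right[of y a] by (simp add: mult.assoc)
    qed
  qed
  then show "x \<in> Rpow m \<Longrightarrow> x * a \<in> Rpow m" by blast
qed

lemma Rpow_decreasing: "Rpow (Suc m) \<subseteq> Rpow m"
proof (rule Rpow_subsetI[OF subspace_Rpow])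
  fix x xs assume *: "x \<in> R" "set xs \<subseteq> R" "length xs = Suc m"
  then obtain ys y where xs: "xs = ys @ [y]" by (cases xs rule: rev_cases) auto
  then show "foldl (*) x xs \<in> Rpow m"
    using Rpow_right[OF Rpow_product[of x ys], of y] * by simp
qed

lemma Rpow_subset_R: "Rpow m \<subseteq> R"
  by (induction m) (use Rpow_0 Rpow_decreasing in blast)+

lemma Rpow_eventually_zero: "\<exists>m. Rpow m = {0}"
proof -
  obtain m where m: "\<forall>x xs. x \<in> R \<and> set xs \<subseteq> R \<and> length xs = m \<longrightarrow> foldl (*) x xs = 0"
    using R_nilpotent by (auto simp: nilpotent_set_def)
  then have "Rpow m \<subseteq> {0}" by (intro Rpow_subsetI) auto
  then show ?thesis using subspace_0[OF subspace_Rpow] by blast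
qed

text \<open>
  The linear projections of the algebra along \<open>R\<close> that preserve \<open>I\<close> and are multiplicative up to the
  power of \<open>R\<close> with exponent \<open>m + 1\<close>.
\<close>

definition lifting :: "'a set \<Rightarrow> nat \<Rightarrow> ('a \<Rightarrow> 'a) \<Rightarrow> bool" where
  "lifting I m s \<longleftrightarrow> (\<forall>x y. s (x + y) = s x + s y) \<and> (\<forall>c x. s (c *s x) = c *s s x) \<and>
    (\<forall>x. s x - x \<in> R) \<and> (\<forall>x\<in>R. s x = 0) \<and> (\<forall>x\<in>I. s x \<in> I) \<and>
    (\<forall>x y. s x * s y - s (x * y) \<in> Rpow m)"

text \<open>
  The vanishing of the second Hochschild cohomology of a separable algebra, made explicit. Modulo
  \<open>N = Rpow (Suc m)\<close> a product of two values of \<open>f\<close> is zero, so \<open>s\<close> acts multiplicatively on these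
  values. The invariance of the tensor and the cocycle identity then show that the coboundary of \<open>G\<close>
  is \<open>s u * f\<close> and that of \<open>h\<close> is \<open>f - s u * f\<close>.
\<close>

lemma lifting_step:
  assumes sep: "separable_algebra (quotient_algebra (concrete_algebra UNIV (*) scale) R)"
    and I: "subspace I" "\<And>a x. x \<in> I \<Longrightarrow> a * x \<in> I"
    and s: "lifting I m s"
  shows "\<exists>s'. lifting I (Suc m) s'"
proof -
  have s_add: "s (x + y) = s x + s y" and s_scale: "s (c *s x) = c *s s x"
    and s_R: "x \<in> R \<Longrightarrow> s x = 0" and s_I: "x \<in> I \<Longrightarrow> s x \<in> I" and s_sec: "s x - x \<in> R"
    and s_mult: "s x * s y - s (x * y) \<in> Rpow m" for c x y
    using s by (simp_all add: lifting_def)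
  obtain D coord where "quotient_coordinates scale R D coord"
    using quotient_coordinates_exist subspace_R R_left R_right by blast
  then interpret qc: quotient_coordinates scale R D coord .
  obtain \<epsilon> where
    inv': "\<forall>\<beta> x. qc.bilinear_mod_R \<beta> \<longrightarrow>
      (\<Sum>p\<in>D. \<Sum>q\<in>D. \<epsilon> p q *s \<beta> (x * p) q) = (\<Sum>p\<in>D. \<Sum>q\<in>D. \<epsilon> p q *s \<beta> p (q * x))"
    and unit: "\<forall>x. (\<Sum>p\<in>D. \<Sum>q\<in>D. \<epsilon> p q *s (p * q)) * x - x \<in> R"
    using qc.separability_bilinear[OF sep] by blast
  define T where "T b = (\<Sum>p\<in>D. \<Sum>q\<in>D. \<epsilon> p q *s b p q)" for b :: "'a \<Rightarrow> 'a \<Rightarrow> 'a"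
  have inv: "T (\<lambda>p q. \<beta> (x * p) q) = T (\<lambda>p q. \<beta> p (q * x))" if "qc.bilinear_mod_R \<beta>" for \<beta> x
    using inv' that unfolding T_def by blast
  have T_add: "T (\<lambda>p q. b p q + b' p q) = T b + T b'" for b b'
    by (simp add: T_def scale_right_distrib sum.distrib)
  have T_diff: "T (\<lambda>p q. b p q - b' p q) = T b - T b'" for b b'
    by (simp add: T_def scale_right_diff_distrib sum_subtractf)
  have T_scale: "T (\<lambda>p q. c *s b p q) = c *s T b" for b c
    by (simp add: T_def scale_sum_right mult.commute)
  have T_left: "a * T b = T (\<lambda>p q. a * b p q)" for a b
    by (simp add: T_def sum_distrib_left scale_mult_right)
  have T_right: "T b * a = T (\<lambda>p q. b p q * a)" for a b
    by (simp add: T_def sum_distrib_right scale_mult_left)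
  have T_in: "T b \<in> N" if "subspace N" "\<And>p q. b p q \<in> N" for b N
    unfolding T_def using that by (intro subspace_sum subspace_scale) auto
  have s_0: "s 0 = 0" using s_scale[of 0 0] by simp
  have s_sum: "s (\<Sum>i\<in>A. h i) = (\<Sum>i\<in>A. s (h i))" for h :: "'a \<Rightarrow> 'a" and A
    by (induction A rule: infinite_finite_induct) (simp_all add: s_add s_0)
  have s_T: "s (T b) = T (\<lambda>p q. s (b p q))" for b
    by (simp add: T_def s_sum s_scale)
  have s_diff: "s (x - y) = s x - s y" for x y
    using s_add[of "x - y" y] by simp
  have s_cong: "s x = s y" if "x - y \<in> R" for x y
    using s_R[OF that] by (simp add: s_diff)

  \<comment> \<open>a representative of the identity of the quotient; it is a left identity by the choice of the tensor, and a right identity after applying the section\<close>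
  define u where "u = T (\<lambda>p q. p * q)"
  have u_left: "u * x - x \<in> R" for x using unit[rule_format, of x] by (simp add: u_def T_def)
  have s_u_right: "s (x * u) = s x" for x
  proof -
    have "T (\<lambda>p q. s (x * p * q)) = T (\<lambda>p q. s (p * (q * x)))"
      using inv[of "\<lambda>v w. s (v * w)" x]
      by (simp add: qc.bilinear_mod_R_def mult.assoc distrib_left distrib_right s_add scale_mult_left scale_mult_right s_scale
            s_R R_left R_right)
    then have "s (x * u) = s (u * x)"
      by (simp add: u_def T_left T_right s_T mult.assoc)
    then show ?thesis using s_cong[OF u_left[of x]] by simp
  qed

  define f where "f x y = s x * s y - s (x * y)" for x y
  have f_Rpow: "f x y \<in> Rpow m" for x y by (simp add: f_def s_mult)
  have f_add: "f (x + y) z = f x z + f y z" "f z (x + y) = f z x + f z y" for x y z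
    by (simp_all add: f_def s_add distrib_left distrib_right)
  have f_scale: "f (c *s x) z = c *s f x z" "f z (c *s x) = c *s f z x" for c x z
    by (simp_all add: f_def s_scale scale_mult_left scale_mult_right scale_right_diff_distrib)
  have f_zero: "f x y = 0" if "x \<in> R \<or> y \<in> R" for x y
    using that by (auto simp: f_def s_R R_left R_right)
  have f_I: "f x y \<in> I" if "y \<in> I" for x y
    using that I s_I by (simp add: f_def subspace_diff)
  have s_s: "s x * s y = s (x * y) + f x y" for x y by (simp add: f_def)
  have cocycle: "f (a * b) c = s a * f b c + f a (b * c) - f a b * s c" for a b c
    by (simp add: f_def algebra_simps)
  have f_u: "f (u * a) b = f a b" for a b
    using f_add(1)[of "u * a - a" a b] f_zero[of "u * a - a" b] u_left[of a] by simp

  define N where "N = Rpow (Suc m)"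
  note N_simps = subspace_add[OF subspace_Rpow[of "Suc m"], folded N_def]
    subspace_diff[OF subspace_Rpow[of "Suc m"], folded N_def]
    subspace_neg[OF subspace_Rpow[of "Suc m"], folded N_def]
  have N_mult: "x * y \<in> N" if "x \<in> Rpow m" "y \<in> Rpow m" for x y
    using Rpow_mult_R[OF that(1)] that(2) Rpow_subset_R unfolding N_def by blast
  have subN: "subspace N" unfolding N_def by (rule subspace_Rpow)

  \<comment> \<open>the contraction of the tensor with f, and its correction h\<close>
  define G where "G x = T (\<lambda>p q. s p * f q x)" for x
  define h where "h x = s u * f u x - f u x" for x
  define g where "g x = G x + h x" for x
  have g_Rpow: "g x \<in> Rpow m" for x
    unfolding g_def G_def h_def
    by (intro subspace_add subspace_diff T_in subspace_Rpow Rpow_left f_Rpow)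
  have G_eq: "s a * G b - G (a * b) + G a * s b - s u * f a b \<in> N" for a b
  proof -
    have "s a * G b = T (\<lambda>p q. s (a * p) * f q b) + T (\<lambda>p q. f a p * f q b)"
      unfolding G_def T_left T_add[symmetric]
      by (simp add: mult.assoc[symmetric] s_s distrib_right)
    also have "T (\<lambda>p q. s (a * p) * f q b) = T (\<lambda>p q. s p * f (q * a) b)"
      by (rule inv[of "\<lambda>v w. s v * f w b"])
         (simp add: qc.bilinear_mod_R_def distrib_left distrib_right s_add s_scale f_add f_scale f_zero s_R
            scale_mult_left scale_mult_right)
    also have "\<dots> = T (\<lambda>p q. s p * s q) * f a b + G (a * b) - G a * s b"
      unfolding G_def T_right T_add[symmetric] T_diff[symmetric]
      by (simp add: cocycle algebra_simps)
    also have "T (\<lambda>p q. s p * s q) = s u + T f"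
      unfolding u_def s_T T_add[symmetric] by (simp add: s_s)
    finally have "s a * G b - G (a * b) + G a * s b - s u * f a b =
        T f * f a b + T (\<lambda>p q. f a p * f q b)"
      by (simp add: algebra_simps)
    moreover have "T f \<in> Rpow m" by (intro T_in subspace_Rpow f_Rpow)
    then have "T f * f a b \<in> N" using f_Rpow by (rule N_mult)
    moreover have "T (\<lambda>p q. f a p * f q b) \<in> N" by (intro T_in subN N_mult f_Rpow)
    ultimately show ?thesis using N_simps(1) by simp
  qed
  have h_eq: "s a * h b - h (a * b) + h a * s b - (f a b - s u * f a b) \<in> N" for a b
  proof -
    have "s a * h b = (s a * s u - s a) * f u b"
      by (simp add: h_def algebra_simps)
    also have "s a * s u - s a = f a u" by (simp add: s_s s_u_right)
    finally have 1: "s a * h b = f a u * f u b" .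
    \<comment> \<open>the cocycle identity for the triple u, a, b evaluates the coboundary of f u\<close>
    define z where "z = f u (a * b) - f u a * s b"
    have z: "z = f a b - s u * f a b"
      using cocycle[of u a b] by (simp add: z_def f_u algebra_simps)
    have 2: "h a * s b - h (a * b) = z - s u * z"
      by (simp add: h_def z_def algebra_simps)
    have "s u * s u = s u + f u u" by (simp add: s_s s_u_right)
    then have "s u * (s u * f a b) = s u * f a b + f u u * f a b"
      by (simp add: mult.assoc[symmetric] distrib_right)
    then have 3: "z - s u * z = f a b - s u * f a b + f u u * f a b"
      by (simp add: z right_diff_distrib)
    have "s a * h b - h (a * b) + h a * s b - (f a b - s u * f a b) = f a u * f u b + f u u * f a b"
      using 1 2 3 by (simp add: algebra_simps)
    then show ?thesis using N_simps(1) N_mult f_Rpow by simp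
  qed
  have g_eq: "s a * g b - g (a * b) + g a * s b - f a b \<in> N" for a b
    using N_simps(1)[OF G_eq[of a b] h_eq[of a b]] by (simp add: g_def algebra_simps)

  have "lifting I (Suc m) (\<lambda>x. s x - g x)"
    unfolding lifting_def
  proof (intro conjI allI ballI)
    show "s (x + y) - g (x + y) = (s x - g x) + (s y - g y)" for x y
      by (simp add: s_add g_def G_def h_def f_add distrib_left T_add)
    show "s (c *s x) - g (c *s x) = c *s (s x - g x)" for c x
      by (simp add: s_scale g_def G_def h_def f_scale scale_mult_right T_scale
          scale_right_distrib scale_right_diff_distrib)
    show "s x - g x - x \<in> R" for x
      using subspace_diff[OF subspace_R s_sec[of x] subsetD[OF Rpow_subset_R g_Rpow[of x]]]
      by (simp add: algebra_simps)
    show "s x - g x = 0" if "x \<in> R" for x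
      using that by (simp add: s_R g_def G_def h_def f_zero T_def)
    show "s x - g x \<in> I" if "x \<in> I" for x
      unfolding g_def G_def h_def
      by (intro subspace_add[OF I(1)] subspace_diff[OF I(1)] T_in[OF I(1)] I(2) f_I s_I that)
    show "(s x - g x) * (s y - g y) - (s (x * y) - g (x * y)) \<in> Rpow (Suc m)" for x y
    proof -
      have "(s x - g x) * (s y - g y) - (s (x * y) - g (x * y)) =
          g x * g y - (s x * g y - g (x * y) + g x * s y - f x y)"
        by (simp add: f_def algebra_simps)
      also have "\<dots> \<in> N" by (intro N_simps(2) N_mult g_Rpow g_eq)
      finally show ?thesis by (simp add: N_def)
    qed
  qed
  then show ?thesis by blast
qed

end

context nilpotent_ideal
begin

text \<open>
  Repeated application of \<open>lifting_step\<close> ends at a power of \<open>R\<close> that vanishes.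
\<close>

lemma multiplicative_section_exists:
  assumes sep: "separable_algebra (quotient_algebra (concrete_algebra UNIV (*) scale) R)"
    and left_ideal: "is_left_ideal ring_of_type_algebra (concrete_algebra UNIV (*) scale) I"
  shows "\<exists>s. (\<forall>x y. s (x + y) = s x + s y) \<and> (\<forall>c x. s (c *s x) = c *s s x) \<and>
    (\<forall>x. s x - x \<in> R) \<and> (\<forall>x\<in>R. s x = 0) \<and> (\<forall>x\<in>I. s x \<in> I) \<and> (\<forall>x y. s (x * y) = s x * s y)"
proof -
  have I: "subspace I" "\<And>a x. x \<in> I \<Longrightarrow> a * x \<in> I"
    using left_ideal by (simp_all add: is_left_ideal_concrete_algebra_iff)
  have "\<exists>s. lifting I m s" for m
  proof (induction m)
    case 0
    obtain s where s: "Vector_Spaces.linear scale scale s" "\<forall>x. s x - x \<in> R"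
      "\<forall>x\<in>R. s x = 0" "\<forall>x\<in>I. s x \<in> I"
      using linear_section_exists[OF subspace_R I(1)] by (elim exE conjE)
    interpret s: Vector_Spaces.linear scale scale s by (rule s(1))
    have "s x * s y - s (x * y) \<in> R" for x y
    proof -
      have "s x * s y - s (x * y) = (s x - x) * s y + x * (s y - y) - (s (x * y) - x * y)"
        by (simp add: algebra_simps)
      also have "\<dots> \<in> R"
        by (intro subspace_diff[OF subspace_R] subspace_add[OF subspace_R] R_left R_right s(2)[rule_format])
      finally show ?thesis .
    qed
    then have "lifting I 0 s"
      using s(2-4) by (simp add: lifting_def Rpow_0 s.add s.scale)
    then show ?case by (rule exI[of _ s])
  next
    case (Suc m)
    then obtain s where "lifting I m s" ..
    from lifting_step[OF sep I this] show ?case .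
  qed
  moreover obtain m where m: "Rpow m = {0}" using Rpow_eventually_zero ..
  ultimately obtain s where s: "lifting I m s" by blast
  have "s (x * y) = s x * s y" for x y
  proof -
    have "s x * s y - s (x * y) \<in> Rpow m" using s by (simp add: lifting_def)
    then show ?thesis by (simp add: m)
  qed
  then show ?thesis
    using s unfolding lifting_def by (intro exI[of _ s]) simp
qed

text \<open>
  The preimage \<open>L\<close> under \<open>s\<close> of a nilpotent ideal \<open>J\<close> of the complement is a nilpotent ideal of the whole algebra: products of
  \<open>n + 1\<close> elements of \<open>L\<close> lie in the kernel \<open>R\<close> of \<open>s\<close>, so longer products lie in high powers of \<open>R\<close>.
  Hence \<open>J \<subseteq> L \<subseteq> R\<close>, while \<open>J\<close> meets \<open>R\<close> only in zero.
\<close>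

lemma semisimple_complement:
  assumes greatest: "\<And>J. is_two_sided_ideal ring_of_type_algebra (concrete_algebra UNIV (*) scale) J \<Longrightarrow>
      nilpotent_set (concrete_algebra UNIV (*) scale) J \<Longrightarrow> J \<subseteq> R"
    and s: "\<And>x y. s (x + y) = s x + s y" "\<And>c x. s (c *s x) = c *s s x" "\<And>x y. s (x * y) = s x * s y"
      "\<And>x. s x - x \<in> R" "\<And>x. x \<in> R \<Longrightarrow> s x = 0"
    and S: "subspace (range s)"
  shows "semisimple_algebra ring_of_type_algebra (concrete_algebra (range s) (*) scale)"
proof -
  have s0: "s 0 = 0" using s(2)[of 0 0] by simp
  have ker: "x \<in> R" if "s x = 0" for x
    using s(4)[of x] subspace_neg[OF subspace_R, of "- x"] that by simp
  have idem: "s (s x) = s x" for x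
    using s(1)[of "s x - x" x] s(5)[OF s(4)[of x]] by simp
  have s_foldl: "s (foldl (*) x xs) = foldl (*) (s x) (map s xs)" for x xs
    by (induction xs arbitrary: x) (simp_all add: s(3))
  have "J \<subseteq> {0}"
    if "is_two_sided_ideal ring_of_type_algebra (concrete_algebra (range s) (*) scale) J"
      and nil: "nilpotent_set (concrete_algebra (range s) (*) scale) J" for J
  proof -
    have J: "J \<subseteq> range s" "subspace J" "\<And>a x. x \<in> J \<Longrightarrow> s a * x \<in> J" "\<And>a x. x \<in> J \<Longrightarrow> x * s a \<in> J"
      using that(1) by (simp_all add: is_two_sided_ideal_def is_left_ideal_concrete_algebra_iff[OF S])
    define L where "L = {x. s x \<in> J}"
    have "is_two_sided_ideal ring_of_type_algebra (concrete_algebra UNIV (*) scale) L"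
      using J(2) by (simp add: is_two_sided_ideal_def is_left_ideal_concrete_algebra_iff L_def
          subspace_def s s0 J(3,4))
    moreover have "nilpotent_set (concrete_algebra UNIV (*) scale) L"
    proof -
      obtain n where n: "\<forall>x xs. x \<in> J \<and> set xs \<subseteq> J \<and> length xs = n \<longrightarrow> foldl (*) x xs = 0"
        using nil by (auto simp: nilpotent_set_def)
      have base: "foldl (*) x xs \<in> R" if "x \<in> L" "set xs \<subseteq> L" "length xs = n" for x xs
      proof -
        have "s x \<in> J" "set (map s xs) \<subseteq> J" using that(1,2) by (auto simp: L_def)
        then have "s (foldl (*) x xs) = 0"
          using n that(3) by (simp add: s_foldl)
        then show ?thesis by (rule ker)
      qed
      have power: "foldl (*) x xs \<in> Rpow j"
        if "x \<in> L" "set xs \<subseteq> L" "length xs = n + j * Suc n" for x xs j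
        using that
      proof (induction j arbitrary: xs)
        case 0
        then show ?case using base by (simp add: Rpow_0)
      next
        case (Suc j)
        let ?m = "n + j * Suc n"
        have len: "length (take ?m xs) = ?m" "length (drop ?m xs) = Suc n"
          using Suc.prems(3) by simp_all
        obtain y ys where ys: "drop ?m xs = y # ys" "length ys = n"
          using length_Suc_conv[THEN iffD1, OF len(2)] by blast
        have sub: "set (take ?m xs) \<subseteq> L" "y \<in> L" "set ys \<subseteq> L"
          using Suc.prems(2) set_take_subset[of ?m xs] set_drop_subset[of ?m xs] ys(1) by auto
        have "foldl (*) x xs = foldl (*) x (take ?m xs @ y # ys)"
          by (simp add: ys(1)[symmetric])
        also have "\<dots> = foldl (*) x (take ?m xs) * foldl (*) y ys"
          by (simp add: foldl_mult_left)
        also have "\<dots> \<in> Rpow (Suc j)"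
          by (rule Rpow_mult_R[OF Suc.IH[OF Suc.prems(1) sub(1) len(1)] base[OF sub(2,3) ys(2)]])
        finally show ?case .
      qed
      obtain m where m: "Rpow m = {0}" using Rpow_eventually_zero ..
      have "foldl (*) x xs = 0" if "x \<in> L \<and> set xs \<subseteq> L \<and> length xs = n + m * Suc n" for x xs
        using power[of x xs m] that by (simp add: m)
      then show ?thesis
        unfolding nilpotent_set_def by (intro exI[of _ "n + m * Suc n"]) simp
    qed
    ultimately have L: "L \<subseteq> R" by (rule greatest)
    show "J \<subseteq> {0}"
    proof
      fix x assume x: "x \<in> J"
      then have sx: "s x = x" using J(1) idem by auto
      then have "x \<in> R" using x L by (auto simp: L_def)
      then show "x \<in> {0}" using s(5)[of x] sx by simp
    qed
  qed
  moreover have "is_two_sided_ideal ring_of_type_algebra (concrete_algebra (range s) (*) scale) {0}"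
    using subspace_0[OF S]
    by (simp add: is_two_sided_ideal_def is_left_ideal_concrete_algebra_iff[OF S] subspace_def)
  moreover have "nilpotent_set (concrete_algebra (range s) (*) scale) {0}"
    unfolding nilpotent_set_def by (intro exI[of _ 0]) simp
  ultimately show ?thesis
    by (simp add: semisimple_algebra_def is_radical_def)
qed

end

section \<open>The Wedderburn decomposition\<close>

theorem theorem6:
  fixes scale :: "'k::field \<Rightarrow> 'a::ring \<Rightarrow> 'a" and R I :: "'a set"
  assumes "fin_dim_algebra scale"
    and "is_radical ring_of_type_algebra (algebra_of_type scale) R"
    and "separable_algebra (quotient_algebra (algebra_of_type scale) R)"
    and "is_left_ideal ring_of_type_algebra (algebra_of_type scale) I"
  shows "\<exists>S. is_subalgebra ring_of_type_algebra (algebra_of_type scale) S \<and>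
    semisimple_algebra ring_of_type_algebra ((algebra_of_type scale)\<lparr>carrier := S\<rparr>) \<and>
    is_direct_sum ring_of_type_algebra (algebra_of_type scale) UNIV S R \<and>
    is_direct_sum ring_of_type_algebra (algebra_of_type scale) I (I \<inter> S) (I \<inter> R)"
proof -
  interpret fin_dim_algebra scale by (rule assms(1))
  let ?A = "concrete_algebra UNIV (*) scale"
  have rad: "is_two_sided_ideal ring_of_type_algebra ?A R" "nilpotent_set ?A R"
    and greatest: "\<And>J. is_two_sided_ideal ring_of_type_algebra ?A J \<Longrightarrow> nilpotent_set ?A J \<Longrightarrow> J \<subseteq> R"
    using assms(2) unfolding is_radical_def algebra_of_type_eq by simp_all
  have I: "subspace I"
    using assms(4) by (simp add: algebra_of_type_eq is_left_ideal_concrete_algebra_iff)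
  have R: "subspace R" "\<And>a x. x \<in> R \<Longrightarrow> a * x \<in> R" "\<And>a x. x \<in> R \<Longrightarrow> x * a \<in> R"
    using rad(1) by (simp_all add: is_two_sided_ideal_def is_left_ideal_concrete_algebra_iff)
  interpret nilpotent_ideal scale R
    by unfold_locales (fact R rad(2))+
  obtain s where s': "\<forall>x y. s (x + y) = s x + s y" "\<forall>c x. s (scale c x) = scale c (s x)"
    "\<forall>x. s x - x \<in> R" "\<forall>x\<in>R. s x = 0" "\<forall>x\<in>I. s x \<in> I" "\<forall>x y. s (x * y) = s x * s y"
    using multiplicative_section_exists[OF assms(3,4)[unfolded algebra_of_type_eq]] by (elim exE conjE)
  note s = s'[rule_format]
  have s0: "s 0 = 0" using s(2)[of 0 0] by simp
  have S: "subspace (range s)"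
    unfolding subspace_def
  proof (intro conjI ballI allI)
    show "0 \<in> range s" using rangeI[of s 0] s0 by simp
    show "x + y \<in> range s" if "x \<in> range s" "y \<in> range s" for x y
      using that by (auto simp: s(1)[symmetric])
    show "scale c x \<in> range s" if "x \<in> range s" for c x
      using that by (auto simp: s(2)[symmetric])
  qed
  have idem: "s x = x" if x: "x \<in> range s" for x
  proof -
    obtain y where y: "x = s y" using x by blast
    show ?thesis using s(1)[of "s y - y" y] s(4)[OF s(3)[of y]] by (simp add: y)
  qed
  have sum_eq: "U <+>\<^bsub>?A\<^esub> V = {u + v | u v. u \<in> U \<and> v \<in> V}" for U V
    by (auto simp: set_add_def set_mult_def)
  have decompose: "x = s x + (x - s x)" "x - s x \<in> R" for x
    using subspace_neg[OF R(1) s(3)[of x]] by simp_all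
  have disjoint: "x = 0" if "x \<in> range s" "x \<in> R" for x
    using idem[OF that(1)] s(4)[OF that(2)] by simp
  have "is_subalgebra ring_of_type_algebra ?A (range s)"
    using S by (auto simp: is_subalgebra_def submodule_concrete_algebra_iff s(6)[symmetric])
  moreover have "semisimple_algebra ring_of_type_algebra (?A\<lparr>carrier := range s\<rparr>)"
  proof -
    have "?A\<lparr>carrier := range s\<rparr> = concrete_algebra (range s) (*) scale"
      by (simp add: concrete_algebra_def)
    then show ?thesis
      using semisimple_complement[OF greatest s(1) s(2) s(6) s(3) s(4) S] by simp
  qed
  moreover have "is_direct_sum ring_of_type_algebra ?A UNIV (range s) R"
  proof -
    have "x \<in> {u + v | u v. u \<in> range s \<and> v \<in> R}" for x
      using decompose[of x] by blast
    then have "UNIV = range s <+>\<^bsub>?A\<^esub> R" unfolding sum_eq by blast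
    moreover have "range s \<inter> R = {0}"
      using disjoint subspace_0[OF S] subspace_0[OF R(1)] by blast
    ultimately show ?thesis
      using S R(1) by (simp add: is_direct_sum_def submodule_concrete_algebra_iff)
  qed
  moreover have "is_direct_sum ring_of_type_algebra ?A I (I \<inter> range s) (I \<inter> R)"
  proof -
    have "I = (I \<inter> range s) <+>\<^bsub>?A\<^esub> (I \<inter> R)"
      unfolding sum_eq
    proof (intro equalityI subsetI)
      fix x assume x: "x \<in> I"
      then have "s x \<in> I \<inter> range s" "x - s x \<in> I \<inter> R"
        using s(5) I decompose(2) by (auto intro: subspace_diff)
      then show "x \<in> {u + v | u v. u \<in> I \<inter> range s \<and> v \<in> I \<inter> R}"
        using decompose(1)[of x] by blast
    next
      fix x assume "x \<in> {u + v | u v. u \<in> I \<inter> range s \<and> v \<in> I \<inter> R}"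
      then show "x \<in> I" using I by (auto intro: subspace_add)
    qed
    moreover have "(I \<inter> range s) \<inter> (I \<inter> R) = {0}"
      using disjoint subspace_0[OF S] subspace_0[OF R(1)] subspace_0[OF I] by blast
    ultimately show ?thesis
      using S R(1) I by (simp add: is_direct_sum_def submodule_concrete_algebra_iff subspace_inter)
  qed
  ultimately show ?thesis
    unfolding algebra_of_type_eq by (intro exI[of _ "range s"] conjI)
qed

end
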